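(* Let $0<\epsilon\le n/2$, let $x^\ast$ be the solution of $\max\{f(x)=\sum_{i=1}^n\log x_i : x\in\mathbb{R}_{\ge 0}^n,\ Ax\le \mathbb{1}_m\}$, and let $x_r^\ast$ be the minimizer of $f_r$ over the box $B$. The algorithm described in the context computes a point $y^{(T)}\in B$ such that $f_r(y^{(T)})-f_r(x_r^\ast)\le\epsilon$ in a number of iterations $T=\widetilde{O}(n/\epsilon)$. Besides, $\bar{x}:=\exp(y^{(T)})/(1+\epsilon/n)$ is feasible, i.e. $A\bar{x}\le \mathbb{1}_m$, and satisfies $f(x^\ast)-f(\bar{x})\le 5\epsilon=O(\epsilon)$.
   Context: Let $A\in\mathbb{R}^{m\times n}$ have non-negative entries $a_{ij}$ with $\max_{i} a_{ij}=1$ for every column $j$. $\mathbb{1}_k$ is the all-ones vector in $\mathbb{R}^k$; vector inequalities and $\exp$ are entrywise; $\log$ is the natural logarithm (with $\log 0=-\infty$). $\widetilde{O}(\cdot)$ omits factors logarithmic in $m,n,1/\epsilon$ and $\rho$, the ratio of the largest to the smallest non-zero entry of $A$. Parameters: $\beta:=\frac{\epsilon}{6n\log(2mn^2/\epsilon)}$, $\omega:=\log\left(\frac{mn}{1-\epsilon/n}\right)$, $B:=[-\omega,0]^n$, $L:=\max\left\{\frac{4\omega(1+\beta)}{\beta},\ \frac{16n\log(2mn)}{3\epsilon}+\frac13\right\}$, $\tau:=\frac{1}{3L}$, $\eta_0:=\frac{1}{3L}$, $\eta_k:=\frac{1}{1-\tau}\eta_{k-1}$ for $k\ge1$, $T:=\left\lceil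 \log\left(\frac{4n\log(2mn)}{\epsilon}\right)/\log\left(\frac{1}{1-\tau}\right)\right\rceil$. Regularized objective on $\mathbb{R}^n$: $f_r(x):=-\langle \mathbb{1}_n,x\rangle+\frac{\beta}{1+\beta}\sum_{i=1}^m (A\exp(x))_i^{(1+\beta)/\beta}$. Truncated gradient: $\overline{\nabla f_r}(x)\in\mathbb{R}^n$ with $\overline{\nabla_i f_r}(x):=\min\{1,\nabla_i f_r(x)\}$. Algorithm: $x^{(0)}=y^{(0)}=z^{(0)}=-\omega\mathbb{1}_n$, and for $k=1,\dots,T$: $x^{(k)}=\tau z^{(k-1)}+(1-\tau)y^{(k-1)}$; $z^{(k)}=\arg\min_{z\in B}\left\{\frac{1}{2\omega}\|z-z^{(k-1)}\|_2^2+\langle \eta_k\overline{\nabla f_r}(x^{(k)}),z\rangle\right\}$; $y^{(k)}=x^{(k)}+\frac{1}{\eta_kL}(z^{(k)}-z^{(k-1)})$. *)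

theory Defs
  imports "HOL-Analysis.Analysis" "Jordan_Normal_Form.Matrix"
begin

text \<open>Vectors and matrices are those of \<^theory>\<open>Jordan_Normal_Form.Matrix\<close>, so that the
  dimensions are natural numbers and can be quantified over. The entries are indexed from 0.\<close>

hide_type (open) Finite_Cartesian_Product.vec
hide_const (open) Finite_Cartesian_Product.vec
unbundle no vec_syntax
unbundle no inner_syntax

definition normalized_matrix :: "nat \<Rightarrow> nat \<Rightarrow> real mat \<Rightarrow> bool" where
  "normalized_matrix m n A \<longleftrightarrow>
     0 < m \<and> 0 < n \<and> A \<in> carrier_mat m n \<and>
     (\<forall>i<m. \<forall>j<n. 0 \<le> A $$ (i, j)) \<and>
     (\<forall>j<n. Max ((\<lambda>i. A $$ (i, j)) ` {..<m}) = 1)"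

definition entry_ratio :: "real mat \<Rightarrow> real" where
  "entry_ratio A = Max (elements_mat A) / Min (elements_mat A - {0})"

definition ones_vec :: "nat \<Rightarrow> real vec" where
  "ones_vec k = vec k (\<lambda>_. 1)"

text \<open>HOL has \<open>ln 0 = 0\<close>; the objective needs \<open>log 0 = -\<infinity>\<close>.\<close>

definition ext_log :: "real \<Rightarrow> ereal" where
  "ext_log t = (if 0 < t then ereal (ln t) else -\<infinity>)"

definition fair_obj :: "real vec \<Rightarrow> ereal" where
  "fair_obj x = (\<Sum>i<dim_vec x. ext_log (x $ i))"

definition feasible_set :: "real mat \<Rightarrow> real vec set" where
  "feasible_set A =
     {x \<in> carrier_vec (dim_col A). 0\<^sub>v (dim_col A) \<le> x \<and> A *\<^sub>v x \<le> ones_vec (dim_row A)}"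

definition beta_par :: "nat \<Rightarrow> nat \<Rightarrow> real \<Rightarrow> real" where
  "beta_par m n \<epsilon> = \<epsilon> / (6 * n * ln (2 * m * n ^ 2 / \<epsilon>))"

definition omega_par :: "nat \<Rightarrow> nat \<Rightarrow> real \<Rightarrow> real" where
  "omega_par m n \<epsilon> = ln (m * n / (1 - \<epsilon> / n))"

definition dom_box :: "nat \<Rightarrow> nat \<Rightarrow> real \<Rightarrow> real vec set" where
  "dom_box m n \<epsilon> = {x \<in> carrier_vec n. \<forall>i<n. x $ i \<in> {- omega_par m n \<epsilon> .. 0}}"

definition L_par :: "nat \<Rightarrow> nat \<Rightarrow> real \<Rightarrow> real" where
  "L_par m n \<epsilon> =
     max (4 * omega_par m n \<epsilon> * (1 + beta_par m n \<epsilon>) / beta_par m n \<epsilon>)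
         (16 * n * ln (2 * m * n) / (3 * \<epsilon>) + 1 / 3)"

definition tau_par :: "nat \<Rightarrow> nat \<Rightarrow> real \<Rightarrow> real" where
  "tau_par m n \<epsilon> = 1 / (3 * L_par m n \<epsilon>)"

primrec eta_par :: "nat \<Rightarrow> nat \<Rightarrow> real \<Rightarrow> nat \<Rightarrow> real" where
  "eta_par m n \<epsilon> 0 = 1 / (3 * L_par m n \<epsilon>)"
| "eta_par m n \<epsilon> (Suc k) = 1 / (1 - tau_par m n \<epsilon>) * eta_par m n \<epsilon> k"

definition num_iters :: "nat \<Rightarrow> nat \<Rightarrow> real \<Rightarrow> nat" where
  "num_iters m n \<epsilon> = nat \<lceil>ln (4 * n * ln (2 * m * n) / \<epsilon>) / ln (1 / (1 - tau_par m n \<epsilon>))\<rceil>"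

definition f_r :: "real mat \<Rightarrow> real \<Rightarrow> real vec \<Rightarrow> real" where
  "f_r A \<epsilon> x =
     (let \<beta> = beta_par (dim_row A) (dim_col A) \<epsilon> in
      - (ones_vec (dim_col A) \<bullet> x)
      + \<beta> / (1 + \<beta>) * (\<Sum>i<dim_row A. ((A *\<^sub>v map_vec exp x) $ i) powr ((1 + \<beta>) / \<beta>)))"

text \<open>The vector of partial derivatives: \<open>i\<close>-th entry
  \<open>d/dt g (x + t e\<^sub>i)\<close> at \<open>t = 0\<close>.\<close>

definition gradient :: "(real vec \<Rightarrow> real) \<Rightarrow> real vec \<Rightarrow> real vec" where
  "gradient g x =
     vec (dim_vec x) (\<lambda>i. deriv (\<lambda>t. g (x + t \<cdot>\<^sub>v unit_vec (dim_vec x) i)) 0)"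

definition trunc_gradient :: "real mat \<Rightarrow> real \<Rightarrow> real vec \<Rightarrow> real vec" where
  "trunc_gradient A \<epsilon> x = map_vec (min 1) (gradient (f_r A \<epsilon>) x)"

text \<open>Here \<open>(z - z') \<bullet> (z - z')\<close> is the squared Euclidean norm of \<open>z - z'\<close>.\<close>

definition mirror_step ::
    "nat \<Rightarrow> nat \<Rightarrow> real \<Rightarrow> real \<Rightarrow> real vec \<Rightarrow> real vec \<Rightarrow> real vec" where
  "mirror_step m n \<epsilon> \<eta> v z' =
     arg_min_on
       (\<lambda>z. 1 / (2 * omega_par m n \<epsilon>) * ((z - z') \<bullet> (z - z')) + (\<eta> \<cdot>\<^sub>v v) \<bullet> z)
       (dom_box m n \<epsilon>)"

text \<open>The state after \<open>k\<close> iterations is the triple \<open>(x, y, z)\<close> of the \<open>k\<close>-th iterates.\<close>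

primrec iterates :: "real mat \<Rightarrow> real \<Rightarrow> nat \<Rightarrow> real vec \<times> real vec \<times> real vec" where
  "iterates A \<epsilon> 0 =
     (let s = - omega_par (dim_row A) (dim_col A) \<epsilon> \<cdot>\<^sub>v ones_vec (dim_col A) in (s, s, s))"
| "iterates A \<epsilon> (Suc k) =
     (case iterates A \<epsilon> k of (x, y, z) \<Rightarrow>
        let m = dim_row A; n = dim_col A;
            \<tau> = tau_par m n \<epsilon>;
            \<eta> = eta_par m n \<epsilon> (Suc k);
            x' = \<tau> \<cdot>\<^sub>v z + (1 - \<tau>) \<cdot>\<^sub>v y;
            z' = mirror_step m n \<epsilon> \<eta> (trunc_gradient A \<epsilon> x') z;
            y' = x' + (1 / (\<eta> * L_par m n \<epsilon>)) \<cdot>\<^sub>v (z' - z)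
        in (x', y', z'))"

definition y_iter :: "real mat \<Rightarrow> real \<Rightarrow> nat \<Rightarrow> real vec" where
  "y_iter A \<epsilon> k = fst (snd (iterates A \<epsilon> k))"

text \<open>One logarithm that dominates those of \<open>m\<close>, \<open>n\<close>, \<open>1/\<epsilon>\<close> and \<open>\<rho>\<close>, and that exceeds 1
  (as \<open>m\<close>, \<open>n\<close> and \<open>\<rho>\<close> are at least 1). A quantity is in \<open>\<tilde>O(g)\<close> if it is at most
  a constant times \<open>g\<close> times a fixed power of this logarithm.\<close>

definition log_factor :: "nat \<Rightarrow> nat \<Rightarrow> real \<Rightarrow> real \<Rightarrow> real" where
  "log_factor m n \<epsilon> \<rho> = ln (2 + m + n + 1 / \<epsilon> + \<rho>)"

end

theory Submission
  imports Defs
begin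

text \<open>
  The method couples a gradient step with a mirror step. With \<open>q = (1 + \<beta>) / \<beta>\<close>, Jensen's
  inequality bounds \<open>f\<^sub>r (x + d)\<close> by a separable function of \<open>d\<close>, so a coordinatewise step of size
  at most \<open>\<bar>min 1 (\<nabla>\<^sub>j f\<^sub>r)\<bar> / (4 q)\<close> decreases \<open>f\<^sub>r\<close> by at least half of its first-order
  prediction. This decrease pays both for the regret of the mirror step and for the part of the
  gradient that was truncated, hence
  \<open>3 L \<eta>\<^sub>k (f\<^sub>r (y\<^sub>k) - f\<^sub>r u) + \<parallel>u - z\<^sub>k\<parallel>\<^sup>2 / (2 \<omega>)\<close> does not increase with \<open>k\<close>, for every \<open>u\<close> in
  the box. As \<open>3 L \<eta>\<^sub>k\<close> grows like \<open>(1 - \<tau>)\<^sup>-\<^sup>k\<close>, the gap is at most \<open>\<epsilon>\<close> after \<open>T\<close> steps.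

  A constraint violated by more than \<open>\<epsilon> / n\<close> would make the regularizer larger than this permits.
  For the fairness gap, compare with \<open>u = log x\<^sup>* + log (1 - \<epsilon> / n)\<close>, which lies in the box because
  first-order optimality gives \<open>x\<^sup>*\<^sub>j \<ge> 1 / n\<close>, and at which the regularizer is negligible.
\<close>

section \<open>Projected steps on an interval\<close>

definition clip :: "real \<Rightarrow> real \<Rightarrow> real" where
  "clip w t = max (- w) (min 0 t)"

lemma clip_bounds: "0 \<le> w \<Longrightarrow> clip w t \<in> {- w..0}"
  by (auto simp: clip_def)

text \<open>The projection \<open>P\<close> of \<open>t\<close> onto the interval satisfies
  \<open>0 \<le> (z - P) * (P - t)\<close>. This makes \<open>P\<close> minimize the strongly convex
  proximal objective, with quadratic growth around it.\<close>

lemma clip_growth: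
  assumes "0 < w" "z \<in> {- w..0}"
  shows "(clip w (c - w * g) - c)\<^sup>2 / (2 * w) + g * clip w (c - w * g) + (z - clip w (c - w * g))\<^sup>2 / (2 * w)
    \<le> (z - c)\<^sup>2 / (2 * w) + g * z"
proof -
  define t P where "t = c - w * g" and "P = clip w (c - w * g)"
  have "0 \<le> (z - P) * (P - t)"
    using assms unfolding P_def t_def[symmetric] clip_def
    by (auto simp: max_def min_def zero_le_mult_iff)
  then have "(P - c)\<^sup>2 + 2 * w * (g * P) + (z - P)\<^sup>2 \<le> (z - c)\<^sup>2 + 2 * w * (g * z)"
    by (simp add: t_def power2_eq_square algebra_simps)
  then have "((P - c)\<^sup>2 + 2 * w * (g * P) + (z - P)\<^sup>2) / (2 * w) \<le> ((z - c)\<^sup>2 + 2 * w * (g * z)) / (2 * w)"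
    using assms(1) by (simp add: divide_right_mono)
  then show ?thesis
    using assms(1) by (simp add: P_def add_divide_distrib)
qed

text \<open>Projection onto an interval containing \<open>c\<close> neither lengthens nor reverses
  the step from \<open>c\<close>.\<close>

lemma clip_step:
  assumes "0 \<le> w" "c \<in> {- w..0}"
  shows "\<bar>clip w (c - w * g) - c\<bar> \<le> w * \<bar>g\<bar>" and "g * (clip w (c - w * g) - c) \<le> 0"
proof -
  consider "0 \<le> g" | "g \<le> 0" by linarith
  then have "\<bar>clip w (c - w * g) - c\<bar> \<le> w * \<bar>g\<bar> \<and> g * (clip w (c - w * g) - c) \<le> 0"
  proof cases
    case 1
    then have "0 \<le> w * g" using assms by simp
    then have "clip w (c - w * g) \<le> c" "c - clip w (c - w * g) \<le> w * g"
      using assms by (auto simp: clip_def)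
    then show ?thesis using 1 by (simp add: mult_nonneg_nonpos)
  next
    case 2
    then have "w * g \<le> 0" using assms by (simp add: mult_nonneg_nonpos)
    then have "c \<le> clip w (c - w * g)" "clip w (c - w * g) - c \<le> - (w * g)"
      using assms by (auto simp: clip_def)
    then show ?thesis using 2 by (simp add: mult_nonpos_nonneg)
  qed
  then show "\<bar>clip w (c - w * g) - c\<bar> \<le> w * \<bar>g\<bar>" and "g * (clip w (c - w * g) - c) \<le> 0"
    by auto
qed

text \<open>The overflow \<open>g - min 1 g\<close> does not enter the mirror step. It is paid for by the
  displacement \<open>c - P\<close>, which is as large as possible wherever there is overflow.\<close>

lemma truncated_mirror_step:
  fixes g c u w \<eta> :: real
  assumes w: "0 < w" and \<eta>: "0 < \<eta>" "\<eta> \<le> 1" and c: "c \<in> {- w..0}" and u: "u \<in> {- w..0}"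
  defines "P \<equiv> clip w (c - w * (\<eta> * min 1 g))"
  shows "\<eta> * (g * (c - u)) \<le> g * (c - P) + (u - c)\<^sup>2 / (2 * w) - (u - P)\<^sup>2 / (2 * w)"
proof -
  define v where "v = min 1 g"
  have growth: "\<eta> * v * (P - u) \<le> (u - c)\<^sup>2 / (2 * w) - (u - P)\<^sup>2 / (2 * w)"
  proof -
    have "0 \<le> (P - c)\<^sup>2 / (2 * w)" using w by simp
    then show ?thesis
      using clip_growth[OF w u, of c "\<eta> * v"]
      unfolding P_def v_def[symmetric] right_diff_distrib by linarith
  qed
  have "\<eta> * v * (P - c) \<le> 0"
    using clip_step(2)[of w c "\<eta> * v"] w c unfolding P_def v_def by simp
  then have sgn: "0 \<le> v * (c - P)"
    using \<eta> by (auto simp: mult_le_0_iff zero_le_mult_iff)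
  have overflow: "\<eta> * ((g - v) * (c - u)) \<le> (g - v) * (c - P)"
  proof (cases "g \<le> 1")
    case False
    have "0 < w * \<eta>" using w \<eta> by simp
    \<comment> \<open>For \<open>1 < g\<close> the displacement is \<open>\<eta> * w\<close> unless
      the lower end stops it at \<open>c + w\<close>; \<open>\<eta> * (c - u)\<close> stays below
      both.\<close>
    have "\<eta> * (c - u) \<le> \<eta> * (c + w)" using u \<eta> by simp
    moreover have "\<eta> * (c + w) \<le> 1 * (c + w)" using c \<eta> by (intro mult_right_mono) auto
    moreover have "\<eta> * (c + w) \<le> \<eta> * w" using c \<eta> by simp
    moreover have "c - P = min (c + w) (\<eta> * w)"
      using False c \<open>0 < w * \<eta>\<close> by (auto simp: P_def clip_def min_def max_def mult.commute)
    ultimately have "\<eta> * (c - u) \<le> c - P" by simp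
    then show ?thesis
      using False mult_left_mono[of "\<eta> * (c - u)" "c - P" "g - v"]
      by (simp add: v_def mult.left_commute)
  qed (simp add: v_def)
  have "\<eta> * (v * (c - P)) \<le> v * (c - P)"
    using mult_right_mono[OF \<eta>(2) sgn] by simp
  then have "\<eta> * (g * (c - u)) \<le> g * (c - P) + \<eta> * v * (P - u)"
    using overflow by (simp add: algebra_simps)
  then show ?thesis using growth by linarith
qed

section \<open>Inequalities for exponentials and powers\<close>

lemma exp_le_quadratic:
  fixes t :: real
  assumes "\<bar>t\<bar> \<le> 1"
  shows "exp t \<le> 1 + t + t\<^sup>2"
proof (cases "0 \<le> t")
  case True
  then show ?thesis using exp_bound[of t] assms by simp
next
  case False
  define s where "s = - t"
  have s: "0 < s" "s \<le> 1" using False assms by (auto simp: s_def)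
  \<comment> \<open>The product is \<open>1 + s ^ 3\<close>.\<close>
  have "1 \<le> (1 + s) * (1 - s + s\<^sup>2)"
    using s by (simp add: power2_eq_square algebra_simps)
  also have "\<dots> \<le> exp s * (1 - s + s\<^sup>2)"
    using s exp_ge_add_one_self[of s] by (intro mult_right_mono) auto
  finally have "exp (- s) \<le> 1 - s + s\<^sup>2"
    by (simp add: exp_minus field_simps)
  then show ?thesis by (simp add: s_def)
qed

text \<open>Jensen's inequality for the convex function \<open>t powr q\<close>, with the weights
  normalized to sum 1. If they sum to 0, both sides vanish.\<close>

lemma powr_Jensen:
  fixes w b :: "'a \<Rightarrow> real"
  assumes "1 \<le> q" "finite J" "\<And>j. j \<in> J \<Longrightarrow> 0 \<le> w j"
  shows "(\<Sum>j\<in>J. w j * exp (b j)) powr q \<le> (\<Sum>j\<in>J. w j) powr (q - 1) * (\<Sum>j\<in>J. w j * exp (q * b j))"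
proof (cases "(\<Sum>j\<in>J. w j) = 0")
  case True
  then have "w j = 0" if "j \<in> J" for j
    using assms that by (simp add: sum_nonneg_eq_0_iff)
  then show ?thesis by simp
next
  case False
  define s where "s = (\<Sum>j\<in>J. w j)"
  have s: "0 < s" using False assms(3) sum_nonneg[of J w] by (simp add: s_def)
  have J: "J \<noteq> {}" using False by auto
  have "(\<Sum>j\<in>J. (w j / s) *\<^sub>R exp (b j)) powr q \<le> (\<Sum>j\<in>J. (w j / s) * (exp (b j) powr q))"
    using assms s J
    by (intro convex_on_sum[OF _ _ powr_convex, of J q])
      (auto simp: s_def sum_divide_distrib[symmetric])
  then have "((\<Sum>j\<in>J. w j * exp (b j)) / s) powr q \<le> (\<Sum>j\<in>J. w j * exp (q * b j)) / s"
    by (simp add: sum_divide_distrib exp_powr_real mult.commute)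
  then have "(\<Sum>j\<in>J. w j * exp (b j)) powr q \<le> s powr q * ((\<Sum>j\<in>J. w j * exp (q * b j)) / s)"
    using s by (subst (asm) powr_divide) (auto intro!: sum_nonneg simp: assms(3) field_simps)
  also have "\<dots> = s powr (q - 1) * (\<Sum>j\<in>J. w j * exp (q * b j))"
    using s by (simp add: powr_diff)
  finally show ?thesis by (simp add: s_def)
qed


text \<open>With \<open>\<mu>\<close> the weighted mean of \<open>b\<close>, convexity of
  \<open>exp\<close> bounds the sum below by \<open>s * exp \<mu>\<close>, and
  \<open>exp (q * \<mu>)\<close> lies above its tangent. It is the first-order convexity inequality
  for one row.\<close>

lemma powr_tangent:
  fixes w b :: "'a \<Rightarrow> real"
  assumes "0 \<le> q" "finite J" "\<And>j. j \<in> J \<Longrightarrow> 0 \<le> w j"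
  shows "(\<Sum>j\<in>J. w j) powr q + q * ((\<Sum>j\<in>J. w j) powr (q - 1) * (\<Sum>j\<in>J. w j * b j))
    \<le> (\<Sum>j\<in>J. w j * exp (b j)) powr q"
proof (cases "(\<Sum>j\<in>J. w j) = 0")
  case True
  then have "w j = 0" if "j \<in> J" for j
    using assms that by (simp add: sum_nonneg_eq_0_iff)
  then show ?thesis by simp
next
  case False
  define s where "s = (\<Sum>j\<in>J. w j)"
  define \<mu> where "\<mu> = (\<Sum>j\<in>J. w j * b j) / s"
  have s: "0 < s" using False assms(3) sum_nonneg[of J w] by (simp add: s_def)
  have wb: "(\<Sum>j\<in>J. w j * b j) = s * \<mu>" using s by (simp add: \<mu>_def)
  have "s * exp \<mu> = exp \<mu> * (\<Sum>j\<in>J. w j * (1 + (b j - \<mu>)))"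
    using wb by (simp add: algebra_simps sum.distrib sum_subtractf sum_distrib_left[symmetric] s_def)
  also have "\<dots> \<le> exp \<mu> * (\<Sum>j\<in>J. w j * exp (b j - \<mu>))"
    using assms(3) by (intro mult_left_mono sum_mono) auto
  also have "\<dots> = (\<Sum>j\<in>J. w j * exp (b j))"
    by (simp add: sum_distrib_left exp_diff)
  finally have "(s * exp \<mu>) powr q \<le> (\<Sum>j\<in>J. w j * exp (b j)) powr q"
    using s assms by (intro powr_mono2) auto
  moreover have "s powr q * (1 + q * \<mu>) \<le> (s * exp \<mu>) powr q"
    using s exp_ge_add_one_self[of "q * \<mu>"]
    by (simp add: powr_mult exp_powr_real mult.commute[of \<mu> q])
  moreover have "s powr q * (1 + q * \<mu>) = s powr q + q * (s powr (q - 1) * (s * \<mu>))"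
    using s by (simp add: powr_diff algebra_simps)
  ultimately show ?thesis
    unfolding wb s_def[symmetric] by linarith
qed

section \<open>The regularized packing objective\<close>

locale soft_packing =
  fixes m n :: nat and a :: "nat \<Rightarrow> nat \<Rightarrow> real" and q :: real
  assumes a_nonneg: "i < m \<Longrightarrow> j < n \<Longrightarrow> 0 \<le> a i j" and q_ge_1: "1 \<le> q"
begin

definition load :: "(nat \<Rightarrow> real) \<Rightarrow> nat \<Rightarrow> real" where
  "load x i = (\<Sum>j<n. a i j * exp (x j))"

text \<open>This is \<open>f_r\<close> with \<open>q = (1 + \<beta>) / \<beta>\<close>, so that
  \<open>\<beta> / (1 + \<beta>)\<close> becomes \<open>1 / q\<close>; vectors are functions of the
  index.\<close>

definition objective :: "(nat \<Rightarrow> real) \<Rightarrow> real" where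
  "objective x = - (\<Sum>j<n. x j) + (\<Sum>i<m. load x i powr q) / q"

definition grad :: "(nat \<Rightarrow> real) \<Rightarrow> nat \<Rightarrow> real" where
  "grad x j = (\<Sum>i<m. load x i powr (q - 1) * (a i j * exp (x j))) - 1"

lemma load_nonneg: "i < m \<Longrightarrow> 0 \<le> load x i"
  unfolding load_def by (intro sum_nonneg) (auto simp: a_nonneg)

lemma load_term_le: "i < m \<Longrightarrow> j < n \<Longrightarrow> a i j * exp (x j) \<le> load x i"
  unfolding load_def by (intro member_le_sum) (auto simp: a_nonneg)

lemma load_cong: "(\<And>j. j < n \<Longrightarrow> x j = y j) \<Longrightarrow> load x i = load y i"
  by (simp add: load_def)

lemma objective_cong: "(\<And>j. j < n \<Longrightarrow> x j = y j) \<Longrightarrow> objective x = objective y"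
  by (simp add: objective_def cong: load_cong)

text \<open>Exchanging the sums passes from columns, which index the gradient, to rows, where
  \<open>powr_tangent\<close> and \<open>powr_Jensen\<close> apply.\<close>

lemma sum_grad:
  "(\<Sum>j<n. (grad x j + 1) * b j) = (\<Sum>i<m. load x i powr (q - 1) * (\<Sum>j<n. a i j * exp (x j) * b j))"
  unfolding grad_def by (simp add: sum_distrib_right sum_distrib_left mult.assoc) (rule sum.swap)

lemma load_powr: "i < m \<Longrightarrow> load x i powr (q - 1) * load x i = load x i powr q"
  using load_nonneg[of i x] by (cases "load x i = 0") (auto simp: powr_diff)

lemma sum_load_powr: "(\<Sum>i<m. load x i powr q) = (\<Sum>j<n. grad x j + 1)"
  using sum_grad[of x "\<lambda>_. 1"] by (simp add: load_def[symmetric] load_powr)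

lemma objective_convex: "objective x + (\<Sum>j<n. grad x j * (u j - x j)) \<le> objective u"
proof -
  have load_u: "load u i = (\<Sum>j<n. a i j * exp (x j) * exp (u j - x j))" for i
    by (simp add: load_def exp_diff)
  have "(\<Sum>i<m. load x i powr q) + q * (\<Sum>j<n. (grad x j + 1) * (u j - x j))
      = (\<Sum>i<m. load x i powr q + q * (load x i powr (q - 1) * (\<Sum>j<n. a i j * exp (x j) * (u j - x j))))"
    unfolding sum_grad by (simp add: sum.distrib sum_distrib_left)
  also have "\<dots> \<le> (\<Sum>i<m. load u i powr q)"
    unfolding load_u using q_ge_1
    by (intro sum_mono powr_tangent[of q "{..<n}" "\<lambda>j. a _ j * exp (x j)", folded load_def])
      (auto simp: a_nonneg)
  finally have "((\<Sum>i<m. load x i powr q) + q * (\<Sum>j<n. (grad x j + 1) * (u j - x j))) / q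
      \<le> (\<Sum>i<m. load u i powr q) / q"
    using q_ge_1 by (intro divide_right_mono) auto
  then have "(\<Sum>i<m. load x i powr q) / q + (\<Sum>j<n. (grad x j + 1) * (u j - x j))
      \<le> (\<Sum>i<m. load u i powr q) / q"
    using q_ge_1 by (simp add: add_divide_distrib)
  then show ?thesis
    by (simp add: objective_def distrib_right sum.distrib sum_subtractf)
qed

text \<open>\<open>powr_Jensen\<close> in each row, regrouped by columns, bounds the change by a sum
  of one-variable functions, so each coordinate may have its own step length.\<close>

lemma objective_upper:
  "objective (\<lambda>j. x j + d j) \<le> objective x + (\<Sum>j<n. (grad x j + 1) * (exp (q * d j) - 1) / q - d j)"
proof -
  have load_xd: "load (\<lambda>j. x j + d j) i = (\<Sum>j<n. a i j * exp (x j) * exp (d j))" for i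
    by (simp add: load_def exp_add mult.assoc)
  have "(\<Sum>i<m. load (\<lambda>j. x j + d j) i powr q)
      \<le> (\<Sum>i<m. load x i powr (q - 1) * (\<Sum>j<n. a i j * exp (x j) * exp (q * d j)))"
    unfolding load_xd using q_ge_1
    by (intro sum_mono powr_Jensen[of q "{..<n}" "\<lambda>j. a _ j * exp (x j)", folded load_def])
      (auto simp: a_nonneg)
  also have "\<dots> = (\<Sum>i<m. load x i powr q) + (\<Sum>j<n. (grad x j + 1) * (exp (q * d j) - 1))"
    unfolding sum_grad[symmetric] sum_load_powr by (simp add: algebra_simps sum.distrib sum_subtractf)
  finally have "(\<Sum>i<m. load (\<lambda>j. x j + d j) i powr q) / q
      \<le> (\<Sum>i<m. load x i powr q) / q + (\<Sum>j<n. (grad x j + 1) * (exp (q * d j) - 1) / q)"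
    using q_ge_1 by (simp add: divide_right_mono add_divide_distrib[symmetric] sum_divide_distrib[symmetric])
  then show ?thesis
    by (simp add: objective_def sum.distrib sum_subtractf)
qed

lemma grad_ge: "j < n \<Longrightarrow> - 1 \<le> grad x j"
  using a_nonneg by (auto simp: grad_def intro!: sum_nonneg mult_nonneg_nonneg)

text \<open>In a row where column \<open>j\<close> has entry 1 the load is at least
  \<open>exp (x j)\<close>. The bound later keeps the gradient step from leaving the box at
  0.\<close>

lemma grad_ge_exp:
  assumes "i < m" "j < n" "a i j = 1"
  shows "exp (q * x j) - 1 \<le> grad x j"
proof -
  have "exp (q * x j) = exp (x j) powr (q - 1) * (a i j * exp (x j))"
    using assms by (simp add: exp_powr_real exp_add[symmetric] algebra_simps)
  also have "\<dots> \<le> load x i powr (q - 1) * (a i j * exp (x j))"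
    using load_term_le[of i j x] assms q_ge_1 by (intro mult_right_mono powr_mono2) auto
  also have "\<dots> \<le> (\<Sum>i<m. load x i powr (q - 1) * (a i j * exp (x j)))"
    using assms a_nonneg by (intro member_le_sum) auto
  finally show ?thesis by (simp add: grad_def)
qed

text \<open>Beyond its linear part, the separable bound costs at most
  \<open>(grad x j + 1) * q * (d j)\<^sup>2\<close> in coordinate \<open>j\<close>. The step limit
  makes this at most half of the first-order decrease.\<close>

lemma descent:
  assumes small: "\<And>j. j < n \<Longrightarrow> q * \<bar>d j\<bar> \<le> \<bar>min 1 (grad x j)\<bar> / 4"
    and sign: "\<And>j. j < n \<Longrightarrow> grad x j * d j \<le> 0"
  shows "objective (\<lambda>j. x j + d j) \<le> objective x + (\<Sum>j<n. grad x j * d j) / 2"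
proof -
  have "(grad x j + 1) * (exp (q * d j) - 1) / q - d j \<le> grad x j * d j / 2" if j: "j < n" for j
  proof -
    define g where "g = grad x j"
    have g: "- 1 \<le> g" using grad_ge[OF j] by (simp add: g_def)
    have qd: "\<bar>q * d j\<bar> = q * \<bar>d j\<bar>" using q_ge_1 by (simp add: abs_mult)
    have "q * \<bar>d j\<bar> \<le> 1 / 4"
      using small[OF j] g by (auto simp: g_def[symmetric] abs_if min_def split: if_splits)
    then have "exp (q * d j) - 1 \<le> q * d j + (q * d j)\<^sup>2"
      using exp_le_quadratic[of "q * d j"] unfolding qd by simp
    then have "(g + 1) * (exp (q * d j) - 1) / q \<le> (g + 1) * (q * d j + (q * d j)\<^sup>2) / q"
      using g q_ge_1 by (intro divide_right_mono mult_left_mono) auto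
    also have "\<dots> = (g + 1) * d j + (g + 1) * (q * \<bar>d j\<bar>) * \<bar>d j\<bar>"
      using q_ge_1 by (simp add: field_simps power2_eq_square)
    also have "(g + 1) * (q * \<bar>d j\<bar>) \<le> \<bar>g\<bar> / 2"
    proof -
      have "(g + 1) * (q * \<bar>d j\<bar>) \<le> (g + 1) * (\<bar>min 1 g\<bar> / 4)"
        using g small[OF j] by (intro mult_left_mono) (auto simp: g_def)
      \<comment> \<open>Either \<open>g + 1 \<le> 2\<close>, or the minimum is 1 and
        \<open>g + 1 \<le> 2 * g\<close>.\<close>
      also have "\<dots> \<le> \<bar>g\<bar> / 2"
      proof (cases "g \<le> 1")
        case True
        then show ?thesis using mult_right_mono[of "g + 1" 2 "\<bar>g\<bar>"] by (simp add: min_def mult.commute)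
      qed auto
      finally show ?thesis .
    qed
    finally have "(g + 1) * (exp (q * d j) - 1) / q \<le> (g + 1) * d j + \<bar>g * d j\<bar> / 2"
      by (simp add: mult_right_mono abs_mult)
    moreover have "\<bar>g * d j\<bar> = - (g * d j)" using sign[OF j] by (simp add: g_def)
    ultimately have "(g + 1) * (exp (q * d j) - 1) / q \<le> (g + 1) * d j - g * d j / 2"
      by linarith
    moreover have "(g + 1) * d j = g * d j + d j" by (simp add: distrib_right)
    ultimately show ?thesis unfolding g_def[symmetric] by linarith
  qed
  then have "(\<Sum>j<n. (grad x j + 1) * (exp (q * d j) - 1) / q - d j) \<le> (\<Sum>j<n. grad x j * d j / 2)"
    by (intro sum_mono) auto
  then show ?thesis
    using objective_upper[of x d] by (simp add: sum_divide_distrib)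
qed

lemma grad_has_derivative:
  assumes "k < n"
  shows "((\<lambda>t. objective (\<lambda>j. x j + t * of_bool (j = k))) has_real_derivative grad x k) (at 0)"
proof -
  have load_deriv: "((\<lambda>t. load (\<lambda>j. x j + t * of_bool (j = k)) i) has_real_derivative a i k * exp (x k)) (at 0)" for i
    unfolding load_def
    by (rule derivative_eq_intros refl)+
      (use assms in \<open>simp add: of_bool_def mult.commute[of "a i _"] if_distrib[of "\<lambda>c. _ * c"]
        if_distrib[of "\<lambda>c. c * _"] cong: if_cong\<close>)
  have row: "((\<lambda>t. load (\<lambda>j. x j + t * of_bool (j = k)) i powr q) has_real_derivative
      q * (load x i powr (q - 1) * (a i k * exp (x k)))) (at 0)" if "i < m" for i
  proof (cases "load x i = 0")
    \<comment> \<open>A zero load means a zero row, so the function is constant in \<open>t\<close>;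
      otherwise the base of the power is positive and the usual rule applies.\<close>
    case True
    then have "a i j = 0" if "j < n" for j
      using load_term_le[of i j x] a_nonneg[of i j] that \<open>i < m\<close> by (simp add: mult_le_0_iff)
    then show ?thesis using assms q_ge_1 by (simp add: load_def)
  next
    case False
    then have "0 < load x i" using load_nonneg[OF that, of x] by simp
    then show ?thesis
      by (auto intro!: derivative_eq_intros load_deriv[of i])
  qed
  have "((\<lambda>t. \<Sum>j<n. x j + t * of_bool (j = k)) has_real_derivative (\<Sum>j<n. of_bool (j = k))) (at 0)"
    by (auto intro!: derivative_eq_intros)
  moreover have "(\<Sum>j<n. of_bool (j = k)) = (1 :: real)"
    using assms by (simp add: of_bool_def)
  ultimately have lin: "((\<lambda>t. \<Sum>j<n. x j + t * of_bool (j = k)) has_real_derivative 1) (at 0)"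
    by simp
  have "((\<lambda>t. (\<Sum>i<m. load (\<lambda>j. x j + t * of_bool (j = k)) i powr q) / q) has_real_derivative
      (\<Sum>i<m. q * (load x i powr (q - 1) * (a i k * exp (x k)))) / q) (at 0)"
    by (intro DERIV_cdivide DERIV_sum row) auto
  then have "((\<lambda>t. (\<Sum>i<m. load (\<lambda>j. x j + t * of_bool (j = k)) i powr q) / q) has_real_derivative
      grad x k + 1) (at 0)"
    using q_ge_1 by (simp add: grad_def sum_distrib_left[symmetric])
  from DERIV_add[OF DERIV_minus[OF lin] this] show ?thesis
    by (simp add: objective_def)
qed

section \<open>Accelerated coordinate descent\<close>

text \<open>The step \<open>y' - x\<close> is \<open>z' - z\<close> scaled by
  \<open>1 / (\<eta> * L)\<close>, so one displacement serves both \<open>descent\<close> and the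
  mirror step. The second conclusion says that the gradient step cannot cross 0.\<close>

lemma accelerated_step:
  fixes x y z y' z' u :: "nat \<Rightarrow> real" and \<omega> L \<eta> \<tau> :: real
  assumes \<omega>: "0 < \<omega>" and L: "4 * \<omega> * q \<le> L" "1 < 3 * L" and \<tau>: "\<tau> = 1 / (3 * L)" and \<eta>: "0 < \<eta>" "\<eta> \<le> 1"
    and z_box: "\<And>j. j < n \<Longrightarrow> z j \<in> {- \<omega>..0}" and u_box: "\<And>j. j < n \<Longrightarrow> u j \<in> {- \<omega>..0}"
    and x: "\<And>j. j < n \<Longrightarrow> x j = \<tau> * z j + (1 - \<tau>) * y j"
    and z': "\<And>j. j < n \<Longrightarrow> z' j = clip \<omega> (z j - \<omega> * (\<eta> * min 1 (grad x j)))"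
    and y': "\<And>j. j < n \<Longrightarrow> y' j = x j + (z' j - z j) / (\<eta> * L)"
  shows accelerated_step_potential:
      "3 * L * \<eta> * (objective y' - objective u) + (\<Sum>j<n. (u j - z' j)\<^sup>2 / (2 * \<omega>))
        \<le> 3 * L * (\<eta> * (1 - \<tau>)) * (objective y - objective u) + (\<Sum>j<n. (u j - z j)\<^sup>2 / (2 * \<omega>))"
    and accelerated_step_nonpos: "\<And>i j. \<lbrakk>i < m; j < n; a i j = 1; x j \<le> 0\<rbrakk> \<Longrightarrow> y' j \<le> 0"
proof -
  define d where "d = (\<lambda>j. (z' j - z j) / (\<eta> * L))"
  have "0 < \<omega> * q" using \<omega> q_ge_1 by simp
  then have L0: "0 < L" using L(1) by simp
  have small: "q * \<bar>d j\<bar> \<le> \<bar>min 1 (grad x j)\<bar> / 4" if j: "j < n" for j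
  proof -
    define v where "v = \<bar>min 1 (grad x j)\<bar>"
    have "\<bar>z' j - z j\<bar> \<le> \<omega> * \<bar>\<eta> * min 1 (grad x j)\<bar>"
      using clip_step(1)[of \<omega> "z j" "\<eta> * min 1 (grad x j)"] z_box[OF j] \<omega> by (simp add: z'[OF j])
    then have "\<bar>z' j - z j\<bar> \<le> \<omega> * \<eta> * v"
      using \<eta> by (simp add: v_def abs_mult mult.assoc)
    then have "\<bar>d j\<bar> \<le> \<omega> * \<eta> * v / (\<eta> * L)"
      using \<eta> L0 divide_right_mono[of "\<bar>z' j - z j\<bar>" "\<omega> * \<eta> * v" "\<eta> * L"] by (simp add: d_def abs_mult)
    then have "q * \<bar>d j\<bar> \<le> q * (\<omega> * \<eta> * v / (\<eta> * L))"
      using q_ge_1 by (intro mult_left_mono) auto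
    \<comment> \<open>\<open>\<eta>\<close> cancels, so the limit of \<open>descent\<close> reduces
      to \<open>4 * \<omega> * q \<le> L\<close>, independent of the iteration.\<close>
    also have "\<dots> = (4 * \<omega> * q) * v / (4 * L)" using \<eta> by simp
    also have "\<dots> \<le> L * v / (4 * L)"
      using L(1) L0 by (intro divide_right_mono mult_right_mono) (auto simp: v_def)
    finally show ?thesis using L0 by (simp add: v_def)
  qed
  have sign: "grad x j * d j \<le> 0" if j: "j < n" for j
  proof -
    have "\<eta> * min 1 (grad x j) * (z' j - z j) \<le> 0"
      using clip_step(2)[of \<omega> "z j" "\<eta> * min 1 (grad x j)"] z_box[OF j] \<omega> by (simp add: z'[OF j])
    then have "min 1 (grad x j) * (z' j - z j) \<le> 0"
      using \<eta> by (auto simp: mult_le_0_iff zero_le_mult_iff)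
    \<comment> \<open>Truncation at 1 does not change the sign of the gradient.\<close>
    then have "grad x j * (z' j - z j) \<le> 0"
      by (auto simp: mult_le_0_iff min_def split: if_splits)
    then show ?thesis
      using \<eta> L0 by (simp add: d_def divide_nonpos_pos)
  qed
  \<comment> \<open>A positive derivative moves the coordinate down. Otherwise its size is at most
    \<open>- (q * x j)\<close>, so the upward step is at most a quarter of the distance to
    0.\<close>
  show nonpos: "y' j \<le> 0" if "i < m" and j: "j < n" and "a i j = 1" and "x j \<le> 0" for i j
  proof (cases "0 < grad x j")
    case True
    then have "d j \<le> 0" using sign[OF j] by (simp add: mult_le_0_iff)
    then show ?thesis using \<open>x j \<le> 0\<close> by (simp add: y'[OF j] d_def)
  next
    case False
    have "q * d j \<le> q * \<bar>d j\<bar>" using q_ge_1 by (intro mult_left_mono) auto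
    also have "\<dots> \<le> - grad x j / 4" using False small[OF j] by (simp add: min_def split: if_splits)
    also have "- grad x j \<le> - (q * x j)"
      using grad_ge_exp[OF that(1-3), of x] exp_ge_add_one_self[of "q * x j"] by linarith
    finally have "q * d j \<le> q * (- x j / 4)" by (simp add: divide_right_mono)
    then have "d j \<le> - x j / 4" by (rule mult_left_le_imp_le) (use q_ge_1 in simp)
    then show ?thesis using \<open>x j \<le> 0\<close> by (simp add: y'[OF j] d_def)
  qed
  define X Y Y' U S where "X = objective x" and "Y = objective y" and "Y' = objective y'"
    and "U = objective u" and "S = (\<Sum>j<n. grad x j * d j)"
  define \<Delta> where "\<Delta> = (\<Sum>j<n. (u j - z j)\<^sup>2 / (2 * \<omega>)) - (\<Sum>j<n. (u j - z' j)\<^sup>2 / (2 * \<omega>))"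
  have "objective y' = objective (\<lambda>j. x j + d j)"
    by (rule objective_cong) (simp add: y' d_def)
  then have desc: "Y' \<le> X + S / 2"
    using descent[of d x] small sign by (simp add: Y'_def X_def S_def)
  have "S \<le> 0" unfolding S_def using sign by (intro sum_nonpos) auto
  have mirror: "\<eta> * (\<Sum>j<n. grad x j * (z j - u j)) \<le> - (\<eta> * L * S) + \<Delta>"
  proof -
    have "\<eta> * (grad x j * (z j - u j)) \<le>
        - (\<eta> * L * (grad x j * d j)) + ((u j - z j)\<^sup>2 / (2 * \<omega>) - (u j - z' j)\<^sup>2 / (2 * \<omega>))" if j: "j < n" for j
    proof -
      have "\<eta> * L * (grad x j * d j) = - (grad x j * (z j - z' j))"
        using \<eta> L0 by (simp add: d_def field_simps)
      then show ?thesis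
        using truncated_mirror_step[OF \<omega> \<eta> z_box[OF j] u_box[OF j], of "grad x j"]
        by (simp add: z'[OF j])
    qed
    then have "(\<Sum>j<n. \<eta> * (grad x j * (z j - u j))) \<le>
        (\<Sum>j<n. - (\<eta> * L * (grad x j * d j)) + ((u j - z j)\<^sup>2 / (2 * \<omega>) - (u j - z' j)\<^sup>2 / (2 * \<omega>)))"
      by (intro sum_mono) auto
    then show ?thesis
      by (simp add: sum.distrib sum_subtractf sum_negf sum_distrib_left[symmetric] S_def \<Delta>_def)
  qed
  have coupling: "(\<Sum>j<n. grad x j * (x j - z j)) \<le> (3 * L - 1) * (Y - X)"
  proof -
    \<comment> \<open>\<open>x\<close> divides the segment from \<open>y\<close> to \<open>z\<close>
      in the ratio given by \<open>(1 - \<tau>) / \<tau> = 3 * L - 1\<close>.\<close>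
    have "x j - z j = (3 * L - 1) * (y j - x j)" if j: "j < n" for j
      using L0 by (simp add: x[OF j] \<tau> field_simps)
    then have "(\<Sum>j<n. grad x j * (x j - z j)) = (3 * L - 1) * (\<Sum>j<n. grad x j * (y j - x j))"
      by (simp add: sum_distrib_left mult.left_commute)
    also have "\<dots> \<le> (3 * L - 1) * (Y - X)"
      using objective_convex[of x y] L(2) by (intro mult_left_mono) (auto simp: X_def Y_def)
    finally show ?thesis .
  qed
  have "X - U \<le> (\<Sum>j<n. grad x j * (x j - u j))"
    using objective_convex[of x u] by (simp add: X_def U_def sum_subtractf right_diff_distrib)
  also have "\<dots> = (\<Sum>j<n. grad x j * (x j - z j)) + (\<Sum>j<n. grad x j * (z j - u j))"
    by (simp add: sum.distrib[symmetric] right_diff_distrib)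
  finally have "\<eta> * (X - U) \<le> \<eta> * ((3 * L - 1) * (Y - X)) + \<eta> * (\<Sum>j<n. grad x j * (z j - u j))"
    using coupling \<eta> mult_left_mono[of "X - U" "(3 * L - 1) * (Y - X) + (\<Sum>j<n. grad x j * (z j - u j))" \<eta>]
    by (simp add: distrib_left)
  also have "\<dots> \<le> \<eta> * ((3 * L - 1) * (Y - X)) + \<eta> * L * (2 * (X - Y')) + \<Delta>"
    using mirror desc \<eta> L0 mult_left_mono[of "- S" "2 * (X - Y')" "\<eta> * L"] by simp
  finally have "\<eta> * (X - U) \<le> \<eta> * ((3 * L - 1) * (Y - X)) + \<eta> * L * (2 * (X - Y')) + \<Delta>" .
  \<comment> \<open>The bound above gives \<open>Y'\<close> the weight
    \<open>2 * L * \<eta>\<close>. Replacing the remaining \<open>\<eta> * L * X\<close> by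
    \<open>\<eta> * L * Y'\<close> raises it to \<open>3 * L * \<eta>\<close>.\<close>
  moreover have "\<eta> * L * Y' \<le> \<eta> * L * X"
    using desc \<open>S \<le> 0\<close> \<eta> L0 by (intro mult_left_mono) auto
  ultimately have "3 * L * \<eta> * (Y' - U) \<le> \<eta> * (3 * L - 1) * (Y - U) + \<Delta>"
    by (simp add: algebra_simps)
  moreover have "\<eta> * (3 * L - 1) = 3 * L * (\<eta> * (1 - \<tau>))"
    using L0 by (simp add: \<tau> field_simps)
  ultimately show "3 * L * \<eta> * (objective y' - objective u) + (\<Sum>j<n. (u j - z' j)\<^sup>2 / (2 * \<omega>))
      \<le> 3 * L * (\<eta> * (1 - \<tau>)) * (objective y - objective u) + (\<Sum>j<n. (u j - z j)\<^sup>2 / (2 * \<omega>))"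
    by (simp add: \<Delta>_def Y'_def U_def Y_def)
qed

text \<open>\<open>\<eta> (Suc k) * (1 - \<tau>) = \<eta> k\<close> makes the potentials of
  consecutive steps match, and \<open>3 * L * \<eta> 0 = 1\<close>. The box is part of the induction
  because \<open>x (Suc k) j \<le> 0\<close> rests on the previous \<open>y\<close>.\<close>

lemma accelerated_convergence:
  fixes x y z :: "nat \<Rightarrow> nat \<Rightarrow> real" and \<eta> :: "nat \<Rightarrow> real" and \<omega> L \<tau> :: real
  assumes \<omega>: "0 < \<omega>" and L: "4 * \<omega> * q \<le> L" "1 < 3 * L" and \<tau>: "\<tau> = 1 / (3 * L)"
    and \<eta>_0: "\<eta> 0 = 1 / (3 * L)" and \<eta>_Suc: "\<And>k. \<eta> (Suc k) = 1 / (1 - \<tau>) * \<eta> k" and \<eta>_T: "\<eta> T \<le> 1"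
    and cover: "\<And>j. j < n \<Longrightarrow> \<exists>i<m. a i j = 1"
    and y_0: "\<And>j. j < n \<Longrightarrow> y 0 j = - \<omega>" and z_0: "\<And>j. j < n \<Longrightarrow> z 0 j = - \<omega>"
    and x_Suc: "\<And>k j. j < n \<Longrightarrow> x (Suc k) j = \<tau> * z k j + (1 - \<tau>) * y k j"
    and z_Suc: "\<And>k j. j < n \<Longrightarrow>
      z (Suc k) j = clip \<omega> (z k j - \<omega> * (\<eta> (Suc k) * min 1 (grad (x (Suc k)) j)))"
    and y_Suc: "\<And>k j. j < n \<Longrightarrow> y (Suc k) j = x (Suc k) j + (z (Suc k) j - z k j) / (\<eta> (Suc k) * L)"
  shows accelerated_in_box: "\<And>j. j < n \<Longrightarrow> y T j \<in> {- \<omega>..0}"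
    and accelerated_potential: "\<And>u. (\<And>j. j < n \<Longrightarrow> u j \<in> {- \<omega>..0}) \<Longrightarrow>
      3 * L * \<eta> T * (objective (y T) - objective u)
        \<le> objective (\<lambda>_. - \<omega>) - objective u + (\<Sum>j<n. (u j + \<omega>)\<^sup>2 / (2 * \<omega>))"
proof -
  have \<tau>_bounds: "0 < \<tau>" "\<tau> < 1" using L by (auto simp: \<tau>)
  have \<eta>_pos: "0 < \<eta> k" for k
    by (induction k) (use L \<tau>_bounds in \<open>auto simp: \<eta>_0 \<eta>_Suc\<close>)
  have \<eta>_mono: "\<eta> k \<le> \<eta> (Suc k)" for k
    using \<tau>_bounds \<eta>_pos[of k] by (simp add: \<eta>_Suc field_simps)
  have \<eta>_le_1: "\<eta> k \<le> 1" if "k \<le> T" for k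
    using lift_Suc_mono_le[of \<eta>, OF \<eta>_mono that] \<eta>_T by simp
  have \<eta>_back: "\<eta> (Suc k) * (1 - \<tau>) = \<eta> k" for k
    using \<tau>_bounds by (simp add: \<eta>_Suc)
  have z_box: "z k j \<in> {- \<omega>..0}" if "j < n" for k j
    using that \<omega> clip_bounds[of \<omega>] by (cases k) (auto simp: z_0 z_Suc)
  text \<open>The iterates \<open>y\<close> need not be convex combinations of the \<open>z\<close>. They stay above the
    lower corner because the weight of \<open>z\<close> in \<open>y\<close> is \<open>1 / (\<eta> L)\<close> and only the
    starting point, the corner itself, has a negative weight; they stay below 0
    because the gradient step cannot overshoot.\<close>
  have lower: "(z k j + \<omega>) / (\<eta> k * L) \<le> y k j + \<omega>" if j: "j < n" for k j
  proof (induction k)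
    case 0
    then show ?case using j by (simp add: y_0 z_0)
  next
    case (Suc k)
    have "(z k j + \<omega>) / (\<eta> (Suc k) * L) = (1 - \<tau>) * ((z k j + \<omega>) / (\<eta> k * L))"
      using \<tau>_bounds by (simp add: \<eta>_Suc)
    also have "\<dots> \<le> (1 - \<tau>) * (y k j + \<omega>)"
      using Suc \<tau>_bounds by (intro mult_left_mono) auto
    finally have "(z k j + \<omega>) / (\<eta> (Suc k) * L) \<le> (1 - \<tau>) * (y k j + \<omega>)" .
    moreover have "0 \<le> \<tau> * (z k j + \<omega>)"
      using \<tau>_bounds z_box[OF j, of k] by simp
    moreover have "y (Suc k) j + \<omega> = \<tau> * (z k j + \<omega>) + (1 - \<tau>) * (y k j + \<omega>)
        + ((z (Suc k) j + \<omega>) / (\<eta> (Suc k) * L) - (z k j + \<omega>) / (\<eta> (Suc k) * L))"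
      using j by (simp add: y_Suc x_Suc diff_divide_distrib[symmetric]) (simp add: algebra_simps)
    ultimately show ?case by linarith
  qed
  have step: "(\<forall>j<n. y k j \<in> {- \<omega>..0}) \<and> (\<forall>u. (\<forall>j<n. u j \<in> {- \<omega>..0}) \<longrightarrow>
      3 * L * \<eta> k * (objective (y k) - objective u) + (\<Sum>j<n. (u j - z k j)\<^sup>2 / (2 * \<omega>))
        \<le> objective (\<lambda>_. - \<omega>) - objective u + (\<Sum>j<n. (u j + \<omega>)\<^sup>2 / (2 * \<omega>)))"
    if "k \<le> T" for k
    using that
  proof (induction k)
    case 0
    have "objective (y 0) = objective (\<lambda>_. - \<omega>)" by (rule objective_cong) (simp add: y_0)
    then show ?case using \<omega> L by (simp add: y_0 z_0 \<eta>_0)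
  next
    case (Suc k)
    have IH: "\<And>j. j < n \<Longrightarrow> y k j \<in> {- \<omega>..0}"
      "\<And>u. \<forall>j<n. u j \<in> {- \<omega>..0} \<Longrightarrow>
      3 * L * \<eta> k * (objective (y k) - objective u) + (\<Sum>j<n. (u j - z k j)\<^sup>2 / (2 * \<omega>))
        \<le> objective (\<lambda>_. - \<omega>) - objective u + (\<Sum>j<n. (u j + \<omega>)\<^sup>2 / (2 * \<omega>))"
      using Suc by auto
    note step = accelerated_step[OF \<omega> L \<tau> \<eta>_pos \<eta>_le_1[OF Suc.prems] z_box[of _ k] _
        x_Suc[of _ k] z_Suc[of _ k] y_Suc[of _ k]]
    have "y (Suc k) j \<in> {- \<omega>..0}" if j: "j < n" for j
    proof -
      obtain i where i: "i < m" "a i j = 1" using cover[OF j] by blast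
      have "x (Suc k) j \<le> 0"
        using IH(1)[OF j] z_box[OF j, of k] \<tau>_bounds
        by (simp add: x_Suc[OF j] add_nonpos_nonpos mult_nonneg_nonpos)
      \<comment> \<open>The bound does not mention the comparison point, so
        \<open>\<lambda>_. 0\<close> stands in for it.\<close>
      then have "y (Suc k) j \<le> 0"
        using i j \<omega> by (intro step(2)[of "\<lambda>_. 0"]) auto
      moreover have "0 \<le> (z (Suc k) j + \<omega>) / (\<eta> (Suc k) * L)"
        using z_box[OF j, of "Suc k"] \<eta>_pos[of "Suc k"] L by simp
      ultimately show ?thesis using lower[OF j, of "Suc k"] by simp
    qed
    moreover have "3 * L * \<eta> (Suc k) * (objective (y (Suc k)) - objective u) + (\<Sum>j<n. (u j - z (Suc k) j)\<^sup>2 / (2 * \<omega>))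
        \<le> objective (\<lambda>_. - \<omega>) - objective u + (\<Sum>j<n. (u j + \<omega>)\<^sup>2 / (2 * \<omega>))"
      if "\<forall>j<n. u j \<in> {- \<omega>..0}" for u
    proof -
      have "3 * L * \<eta> (Suc k) * (objective (y (Suc k)) - objective u) + (\<Sum>j<n. (u j - z (Suc k) j)\<^sup>2 / (2 * \<omega>))
          \<le> 3 * L * (\<eta> (Suc k) * (1 - \<tau>)) * (objective (y k) - objective u) + (\<Sum>j<n. (u j - z k j)\<^sup>2 / (2 * \<omega>))"
        using that by (intro step(1)) auto
      also have "\<dots> \<le> objective (\<lambda>_. - \<omega>) - objective u + (\<Sum>j<n. (u j + \<omega>)\<^sup>2 / (2 * \<omega>))"
        unfolding \<eta>_back by (rule IH(2)[OF that])
      finally show ?thesis .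
    qed
    ultimately show ?case by blast
  qed
  note step_T = step[OF order.refl]
  show "y T j \<in> {- \<omega>..0}" if "j < n" for j
    using conjunct1[OF step_T, rule_format, OF that] .
  show "3 * L * \<eta> T * (objective (y T) - objective u)
      \<le> objective (\<lambda>_. - \<omega>) - objective u + (\<Sum>j<n. (u j + \<omega>)\<^sup>2 / (2 * \<omega>))"
    if u: "\<And>j. j < n \<Longrightarrow> u j \<in> {- \<omega>..0}" for u
  proof -
    have "\<forall>j<n. u j \<in> {- \<omega>..0}" using u by blast
    from conjunct2[OF step_T, THEN spec, THEN mp, OF this]
    have "3 * L * \<eta> T * (objective (y T) - objective u) + (\<Sum>j<n. (u j - z T j)\<^sup>2 / (2 * \<omega>))
      \<le> objective (\<lambda>_. - \<omega>) - objective u + (\<Sum>j<n. (u j + \<omega>)\<^sup>2 / (2 * \<omega>))" .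
    moreover have "0 \<le> (\<Sum>j<n. (u j - z T j)\<^sup>2 / (2 * \<omega>))" using \<omega> by (intro sum_nonneg) auto
    ultimately show ?thesis by linarith
  qed
qed

end

section \<open>The parameters\<close>

locale packing_parameters =
  fixes m n :: nat and \<epsilon> :: real
  assumes m_pos: "0 < m" and n_pos: "0 < n" and eps_pos: "0 < \<epsilon>" and eps_le: "\<epsilon> \<le> real n / 2"
begin

abbreviation "\<beta> \<equiv> beta_par m n \<epsilon>"
abbreviation "\<omega> \<equiv> omega_par m n \<epsilon>"
abbreviation "L \<equiv> L_par m n \<epsilon>"
abbreviation "\<tau> \<equiv> tau_par m n \<epsilon>"
definition q :: real where "q = (1 + \<beta>) / \<beta>"
definition \<delta> :: real where "\<delta> = \<epsilon> / real n"
definition M :: real where "M = real m * real n"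
text \<open>The argument of the logarithm in \<open>\<beta>\<close>.\<close>

definition K :: real where "K = 2 * real m * (real n)\<^sup>2 / \<epsilon>"
text \<open>The factor by which \<open>\<eta>\<close> has to grow; \<open>num_iters\<close> takes
  its logarithm.\<close>

definition R :: real where "R = 4 * real n * ln (2 * M) / \<epsilon>"

lemma M_ge_1: "1 \<le> M"
proof -
  have "1 \<le> m * n" using m_pos n_pos by simp
  then have "1 \<le> real (m * n)" by linarith
  then show ?thesis by (simp add: M_def)
qed

lemma n_le_M: "real n \<le> M"
  using m_pos mult_right_mono[of 1 "real m" "real n"] by (simp add: M_def)

lemma delta_bounds: "0 < \<delta>" "\<delta> \<le> 1 / 2"
  using eps_pos eps_le n_pos by (auto simp: \<delta>_def field_simps)

lemma K_delta: "K * \<delta> = 2 * M"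
  using eps_pos n_pos by (simp add: K_def \<delta>_def M_def power2_eq_square)

lemma K_ge: "4 * M \<le> K"
proof -
  have "0 < K" using m_pos n_pos eps_pos by (simp add: K_def)
  then have "K * \<delta> \<le> K * (1 / 2)" using delta_bounds by (intro mult_left_mono) auto
  then show ?thesis unfolding K_delta by linarith
qed

lemma K_ge_4: "4 \<le> K"
  using K_ge M_ge_1 by linarith

lemma ln_K_ge: "1 \<le> ln K"
proof -
  have "exp 1 \<le> K" using exp_le K_ge_4 by linarith
  then show ?thesis using K_ge_4 by (simp add: ln_ge_iff)
qed

lemma ln_K_le: "ln K \<le> K / 2"
proof -
  have "ln (2 * (K / 2)) = ln 2 + ln (K / 2)"
    using K_ge_4 by (intro ln_mult_pos) auto
  then show ?thesis
    using ln_le_minus_one[of "K / 2"] ln_2_less_1 K_ge_4 by simp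
qed

lemma beta_eq: "\<beta> = \<delta> / (6 * ln K)"
  by (simp add: beta_par_def \<delta>_def K_def)

lemma beta_bounds: "0 < \<beta>" "\<beta> \<le> 1 / 12"
proof -
  show "0 < \<beta>" using ln_K_ge delta_bounds by (simp add: beta_eq)
  have "\<delta> / (6 * ln K) \<le> (1 / 2) / (6 * 1)"
    using ln_K_ge delta_bounds by (intro frac_le) auto
  then show "\<beta> \<le> 1 / 12" by (simp add: beta_eq)
qed

lemma inverse_beta: "1 / \<beta> = 6 * ln K / \<delta>"
  by (simp add: beta_eq)

lemma q_eq: "q = 1 + 1 / \<beta>"
  using beta_bounds by (simp add: q_def field_simps)

lemma q_bounds: "1 \<le> q" "1 / \<beta> \<le> q" "1 / q \<le> \<beta>" "\<beta> / 2 \<le> 1 / q"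
proof -
  show "1 \<le> q" "1 / \<beta> \<le> q" using beta_bounds by (simp_all add: q_eq)
  show "1 / q \<le> \<beta>" "\<beta> / 2 \<le> 1 / q"
    using beta_bounds by (simp_all add: q_def field_simps)
qed

lemma exp_omega: "exp (- \<omega>) = (1 - \<delta>) / M"
  using M_ge_1 delta_bounds m_pos n_pos by (simp add: omega_par_def exp_minus M_def \<delta>_def)

lemma omega_pos: "0 < \<omega>"
proof -
  have "1 < M / (1 - \<delta>)" using M_ge_1 delta_bounds by (simp add: field_simps)
  then show ?thesis by (simp add: omega_par_def M_def \<delta>_def)
qed

lemma omega_le: "\<omega> \<le> ln (2 * M)"
proof -
  have "M / (1 - \<delta>) \<le> M / (1 / 2)"
    using M_ge_1 delta_bounds by (intro divide_left_mono) auto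
  moreover have "0 < M / (1 - \<delta>)"
    using M_ge_1 delta_bounds by (intro divide_pos_pos) auto
  ultimately show ?thesis by (simp add: omega_par_def mult.commute M_def \<delta>_def)
qed

text \<open>\<open>11 / 36\<close> is 1 minus the upper bound \<open>25 / 36\<close> on
  \<open>ln 2\<close>. This slack closes the chain of estimates in
  \<open>load_final_le\<close>.\<close>

lemma ln_2M_bounds: "1 / 2 \<le> ln (2 * M)" "ln (2 * M) \<le> M - 11 / 36"
proof -
  have "ln (2 * M) = ln 2 + ln M"
    using M_ge_1 by (intro ln_mult_pos) auto
  moreover have "0 \<le> ln M" "ln M \<le> M - 1"
    using M_ge_1 by (auto intro!: ln_le_minus_one ln_ge_zero)
  ultimately show "1 / 2 \<le> ln (2 * M)" "ln (2 * M) \<le> M - 11 / 36"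
    using ln2_ge_two_thirds ln2_le_25_over_36 by linarith+
qed

lemma R_ge_4: "4 \<le> R"
proof -
  have "4 * (1 / 2) / (1 / 2) \<le> 4 * ln (2 * M) / \<delta>"
    using ln_2M_bounds delta_bounds by (intro frac_le) auto
  then show ?thesis by (simp add: R_def \<delta>_def mult.commute mult.left_commute)
qed

lemma L_bounds: "4 * \<omega> * q \<le> L" "4 * R + 1 \<le> 3 * L"
proof -
  show "4 * \<omega> * q \<le> L" by (simp add: L_par_def q_def)
  have "16 * n * ln (2 * M) / (3 * \<epsilon>) + 1 / 3 \<le> L" by (simp add: L_par_def M_def mult.assoc)
  moreover have "16 * n * ln (2 * M) / (3 * \<epsilon>) = 4 * R / 3" by (simp add: R_def)
  ultimately show "4 * R + 1 \<le> 3 * L" by linarith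
qed

lemma L_gt: "1 < 3 * L"
  using L_bounds R_ge_4 by linarith

lemma tau_bounds: "0 < \<tau>" "\<tau> < 1"
  using L_gt by (auto simp: tau_par_def)

lemma eta_eq: "eta_par m n \<epsilon> k = (1 / (1 - \<tau>)) ^ k / (3 * L)"
  by (induction k) auto

lemma rate_gt_1: "1 < 1 / (1 - \<tau>)"
  using tau_bounds by simp

lemma num_iters_bounds:
  "ln R / ln (1 / (1 - \<tau>)) \<le> num_iters m n \<epsilon>"
  "num_iters m n \<epsilon> \<le> ln R / ln (1 / (1 - \<tau>)) + 1"
proof -
  have "0 \<le> ln R / ln (1 / (1 - \<tau>))"
    using R_ge_4 rate_gt_1 by (intro divide_nonneg_pos ln_ge_zero ln_gt_zero) auto
  then show "ln R / ln (1 / (1 - \<tau>)) \<le> num_iters m n \<epsilon>"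
    "num_iters m n \<epsilon> \<le> ln R / ln (1 / (1 - \<tau>)) + 1"
    unfolding num_iters_def R_def M_def mult.assoc by linarith+
qed

text \<open>Rounding \<open>num_iters\<close> up to an integer costs at most one factor
  \<open>1 / (1 - \<tau>)\<close>. The lower bound gives convergence, the upper one keeps
  \<open>\<eta>\<close> at most 1.\<close>

lemma rate_power_bounds:
  "R \<le> (1 / (1 - \<tau>)) ^ num_iters m n \<epsilon>"
  "(1 / (1 - \<tau>)) ^ num_iters m n \<epsilon> \<le> R / (1 - \<tau>)"
proof -
  define r where "r = 1 / (1 - \<tau>)"
  have r: "1 < r" "0 < ln r" using rate_gt_1 unfolding r_def by (simp, rule ln_gt_zero)
  note T = num_iters_bounds[folded r_def]
  have pow: "r ^ num_iters m n \<epsilon> = exp (num_iters m n \<epsilon> * ln r)"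
    using r by (simp add: exp_of_nat_mult)
  have "ln R \<le> num_iters m n \<epsilon> * ln r" "num_iters m n \<epsilon> * ln r \<le> ln R + ln r"
    using T r by (auto simp: field_simps)
  then have "exp (ln R) \<le> r ^ num_iters m n \<epsilon>" "r ^ num_iters m n \<epsilon> \<le> exp (ln R + ln r)"
    unfolding pow by simp_all
  then show "R \<le> (1 / (1 - \<tau>)) ^ num_iters m n \<epsilon>"
    "(1 / (1 - \<tau>)) ^ num_iters m n \<epsilon> \<le> R / (1 - \<tau>)"
    using R_ge_4 r(1) by (simp_all add: r_def[symmetric] exp_add) (simp add: r_def)
qed

text \<open>\<open>truncated_mirror_step\<close> requires \<open>\<eta> \<le> 1\<close>. The second
  argument of the maximum in \<open>L\<close> ensures it through
  \<open>4 * R + 1 \<le> 3 * L\<close>.\<close>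

lemma eta_final_le: "eta_par m n \<epsilon> (num_iters m n \<epsilon>) \<le> 1"
proof -
  have "eta_par m n \<epsilon> (num_iters m n \<epsilon>) \<le> R / (1 - \<tau>) / (3 * L)"
    unfolding eta_eq using rate_power_bounds(2) L_gt by (intro divide_right_mono) auto
  also have "\<dots> = R / (3 * L - 1)"
    using L_gt by (simp add: tau_par_def field_simps)
  also have "\<dots> \<le> 1"
    using L_gt L_bounds R_ge_4 by (subst divide_le_eq_1_pos) linarith+
  finally show ?thesis .
qed

text \<open>\<open>- ln (1 - \<tau>)\<close> is at least
  \<open>\<tau> = 1 / (3 * L)\<close>.\<close>

lemma num_iters_le: "num_iters m n \<epsilon> \<le> 3 * L * ln R + 1"
proof -
  have "\<tau> \<le> ln (1 / (1 - \<tau>))"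
    using ln_le_minus_one[of "1 - \<tau>"] tau_bounds by (simp add: ln_div)
  then have "ln R / ln (1 / (1 - \<tau>)) \<le> ln R / \<tau>"
    using R_ge_4 tau_bounds rate_gt_1 by (intro divide_left_mono ln_ge_zero mult_pos_pos ln_gt_zero) auto
  then show ?thesis
    using num_iters_bounds by (simp add: tau_par_def mult.commute)
qed

text \<open>The cube consists of one logarithm each from \<open>\<omega>\<close>,
  \<open>1 / \<beta>\<close> and \<open>R\<close>. The estimates give
  \<open>3 * 720 * 6 = 12960\<close>; the rest of the constant absorbs the ceiling.\<close>

lemma num_iters_bound:
  assumes "0 \<le> \<rho>"
  shows "num_iters m n \<epsilon> \<le> 13000 * (real n / \<epsilon>) * log_factor m n \<epsilon> \<rho> ^ 3"
proof -
  define S where "S = 2 + real m + real n + 1 / \<epsilon>"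
  define l N where "l = log_factor m n \<epsilon> \<rho>" and "N = real n / \<epsilon>"
  have S: "2 \<le> S" "real m \<le> S" "real n \<le> S" "1 / \<epsilon> \<le> S" "4 \<le> S"
  proof -
    have "1 \<le> real m" "1 \<le> real n" "0 < 1 / \<epsilon>" using eps_pos m_pos n_pos by auto
    then show "2 \<le> S" "real m \<le> S" "real n \<le> S" "1 / \<epsilon> \<le> S" "4 \<le> S"
      unfolding S_def by linarith+
  qed
  have lnS: "ln S \<le> l"
    using assms S by (simp add: l_def log_factor_def S_def)
  have "exp 1 \<le> S" using exp_le S by linarith
  then have "1 \<le> ln S" using S by (simp add: ln_ge_iff)
  then have l1: "1 \<le> l" using lnS by linarith
  have N: "2 \<le> N" using eps_le eps_pos by (simp add: N_def field_simps)
  \<comment> \<open>\<open>S\<close> dominates every factor involved, so a product of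
    \<open>k\<close> of them has logarithm at most \<open>k * l\<close>.\<close>
  have ln_le: "ln t \<le> k * l" if "0 < t" "t \<le> S ^ k" for t and k :: nat
  proof -
    have "ln t \<le> ln (S ^ k)" using that by simp
    also have "\<dots> = k * ln S" using S by (simp add: ln_realpow)
    also have "\<dots> \<le> k * l" using lnS by (intro mult_left_mono) auto
    finally show ?thesis .
  qed
  have "2 * M \<le> S * (S * S)" unfolding M_def using S by (intro mult_mono) auto
  then have ln2mn: "ln (2 * M) \<le> 3 * l"
    using ln_le[of "2 * M" 3] M_ge_1 by (simp add: eval_nat_numeral)
  have "2 * real m * (real n)\<^sup>2 * (1 / \<epsilon>) \<le> S * S * S\<^sup>2 * S"
    using S eps_pos by (intro mult_mono power_mono) auto
  then have lnK: "ln K \<le> 5 * l"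
    using ln_le[of K 5] K_ge_4 by (simp add: K_def eval_nat_numeral mult.assoc)
  \<comment> \<open>A crude bound on the logarithm inside \<open>R\<close> suffices here because
    only \<open>ln R\<close> is estimated.\<close>
  have "R \<le> 4 * N * (2 * M)"
    using ln_2M_bounds N M_ge_1 mult_left_mono[of "ln (2 * M)" "2 * M" "4 * N"] by (simp add: N_def R_def)
  also have "\<dots> = 2 * 4 * real n * (real m * real n * (1 / \<epsilon>))" by (simp add: N_def M_def)
  also have "\<dots> \<le> S * S * S * ((S * S) * S)"
    using S eps_pos by (intro mult_mono) auto
  finally have lnR: "ln R \<le> 6 * l"
    using ln_le[of R 6] R_ge_4 by (simp add: eval_nat_numeral mult.assoc)
  have R_le: "R \<le> 12 * N * l"
    using ln2mn N mult_left_mono[of "ln (2 * M)" "3 * l" "4 * N"] by (simp add: N_def R_def)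
  have ll: "l \<le> l\<^sup>2" "1 \<le> l\<^sup>2" using l1 mult_mono[of 1 l 1 l] by (auto simp: power2_eq_square)
  have Nll: "N * l \<le> N * l\<^sup>2" "1 \<le> N * l\<^sup>2"
    using N ll mult_mono[of 1 N 1 "l\<^sup>2"] by auto
  have "q \<le> 2 * (1 / \<beta>)"
    using beta_bounds by (simp add: q_eq field_simps)
  also have "1 / \<beta> = 6 * N * ln K" by (simp add: inverse_beta N_def \<delta>_def)
  also have "\<dots> \<le> 6 * N * (5 * l)" using lnK N by (intro mult_left_mono) auto
  finally have "q \<le> 60 * N * l" by simp
  then have "4 * \<omega> * q \<le> 4 * (3 * l) * (60 * N * l)"
    using omega_le ln2mn omega_pos q_bounds l1 N by (intro mult_mono) auto
  then have "4 * \<omega> * q \<le> 720 * (N * l\<^sup>2)" by (simp add: power2_eq_square)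
  moreover have "16 * n * ln (2 * M) / (3 * \<epsilon>) + 1 / 3 \<le> 720 * (N * l\<^sup>2)"
    proof -
    have "16 * n * ln (2 * M) / (3 * \<epsilon>) = 4 / 3 * R" by (simp add: R_def)
    then show ?thesis using R_le Nll by linarith
  qed
  ultimately have "L \<le> 720 * (N * l\<^sup>2)"
    by (simp add: L_par_def q_def M_def mult.assoc)
  then have "3 * L * ln R \<le> 3 * (720 * (N * l\<^sup>2)) * (6 * l)"
    using lnR R_ge_4 L_gt N by (intro mult_mono) auto
  also have "\<dots> = 12960 * (N * l ^ 3)" by (simp add: power2_eq_square power3_eq_cube)
  finally have "num_iters m n \<epsilon> \<le> 12960 * (N * l ^ 3) + 1" using num_iters_le by linarith
  moreover have "1 * 1 \<le> N * l ^ 3" using N l1 by (intro mult_mono) auto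
  ultimately have "num_iters m n \<epsilon> \<le> 13000 * (N * l ^ 3)" by linarith
  then show ?thesis by (simp add: N_def l_def mult.assoc)
qed

end

section \<open>Convergence of the iterates\<close>

text \<open>The objective separates into coordinates, and \<open>clip_growth\<close> shows that the
  clipped point is the only minimizer. Uniqueness matters because \<open>arg_min_on\<close> picks an
  arbitrary minimizer.\<close>

lemma mirror_step_eq:
  assumes \<omega>: "0 < omega_par m n \<epsilon>" and v: "v \<in> carrier_vec n" and z': "z' \<in> carrier_vec n"
  shows "mirror_step m n \<epsilon> \<eta> v z' =
    vec n (\<lambda>j. clip (omega_par m n \<epsilon>) (z' $ j - omega_par m n \<epsilon> * (\<eta> * v $ j)))"
proof -
  define \<omega> where "\<omega> = omega_par m n \<epsilon>"
  define P where "P = vec n (\<lambda>j. clip \<omega> (z' $ j - \<omega> * (\<eta> * v $ j)))"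
  define \<Phi> where "\<Phi> = (\<lambda>z. 1 / (2 * \<omega>) * ((z - z') \<bullet> (z - z')) + (\<eta> \<cdot>\<^sub>v v) \<bullet> z)"
  have \<omega>_pos: "0 < \<omega>" using \<omega> by (simp add: \<omega>_def)
  have \<Phi>: "\<Phi> z = (\<Sum>j<n. (z $ j - z' $ j)\<^sup>2 / (2 * \<omega>) + \<eta> * v $ j * z $ j)" if "z \<in> carrier_vec n" for z
    using that v z' by (simp add: \<Phi>_def scalar_prod_def sum.distrib sum_divide_distrib power2_eq_square
        lessThan_atLeast0)
  have P_box: "P \<in> dom_box m n \<epsilon>"
    using clip_bounds[of \<omega>] \<omega>_pos by (auto simp: P_def dom_box_def \<omega>_def)
  have growth: "\<Phi> P + (\<Sum>j<n. (z $ j - P $ j)\<^sup>2 / (2 * \<omega>)) \<le> \<Phi> z" if "z \<in> dom_box m n \<epsilon>" for z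
  proof -
    have z: "z \<in> carrier_vec n" "\<And>j. j < n \<Longrightarrow> z $ j \<in> {- \<omega>..0}"
      using that by (auto simp: dom_box_def \<omega>_def)
    have "(\<Sum>j<n. ((P $ j - z' $ j)\<^sup>2 / (2 * \<omega>) + \<eta> * v $ j * P $ j) + (z $ j - P $ j)\<^sup>2 / (2 * \<omega>))
        \<le> (\<Sum>j<n. (z $ j - z' $ j)\<^sup>2 / (2 * \<omega>) + \<eta> * v $ j * z $ j)"
      using clip_growth[OF \<omega>_pos z(2)] by (intro sum_mono) (auto simp: P_def)
    then show ?thesis using z(1) P_box by (simp add: \<Phi> dom_box_def sum.distrib)
  qed
  have "is_arg_min \<Phi> (\<lambda>z. z \<in> dom_box m n \<epsilon>) P"
  proof -
    have "\<Phi> P \<le> \<Phi> z" if "z \<in> dom_box m n \<epsilon>" for z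
    proof -
      have "0 \<le> (\<Sum>j<n. (z $ j - P $ j)\<^sup>2 / (2 * \<omega>))" using \<omega>_pos by (intro sum_nonneg) auto
      then show ?thesis using growth[OF that] by linarith
    qed
    then show ?thesis using P_box by (auto simp: is_arg_min_def not_less)
  qed
  moreover have "z = P" if "is_arg_min \<Phi> (\<lambda>z. z \<in> dom_box m n \<epsilon>) z" for z
  proof -
    have z: "z \<in> dom_box m n \<epsilon>" "\<Phi> z \<le> \<Phi> P"
      using that P_box by (auto simp: is_arg_min_def not_less)
    then have "(\<Sum>j<n. (z $ j - P $ j)\<^sup>2 / (2 * \<omega>)) \<le> 0" using growth by fastforce
    moreover have "0 \<le> (\<Sum>j<n. (z $ j - P $ j)\<^sup>2 / (2 * \<omega>))"
      using \<omega>_pos by (intro sum_nonneg) auto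
    ultimately have "(\<Sum>j<n. (z $ j - P $ j)\<^sup>2 / (2 * \<omega>)) = 0" by linarith
    then have "\<forall>j<n. (z $ j - P $ j)\<^sup>2 / (2 * \<omega>) = 0"
      using \<omega>_pos by (subst (asm) sum_nonneg_eq_0_iff) auto
    then show ?thesis
      using z(1) \<omega>_pos by (intro eq_vecI) (auto simp: dom_box_def P_def)
  qed
  ultimately have "arg_min \<Phi> (\<lambda>z. z \<in> dom_box m n \<epsilon>) = P"
    unfolding arg_min_def by (rule someI2) auto
  then show ?thesis
    by (simp add: mirror_step_def arg_min_on_def \<Phi>_def \<omega>_def P_def)
qed

locale packing_instance = packing_parameters m n \<epsilon> for m n \<epsilon> +
  fixes A :: "real mat"
  assumes normalized: "normalized_matrix m n A"
begin

lemma A_carrier: "A \<in> carrier_mat m n" and A_dims [simp]: "dim_row A = m" "dim_col A = n"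
  using normalized by (auto simp: normalized_matrix_def)

sublocale soft_packing m n "\<lambda>i j. A $$ (i, j)" q
  using normalized q_bounds by unfold_locales (auto simp: normalized_matrix_def)

lemma A_max: "j < n \<Longrightarrow> Max ((\<lambda>i. A $$ (i, j)) ` {..<m}) = 1"
  using normalized by (auto simp: normalized_matrix_def)

lemma A_le_1: "i < m \<Longrightarrow> j < n \<Longrightarrow> A $$ (i, j) \<le> 1"
  using Max_ge[of "(\<lambda>i. A $$ (i, j)) ` {..<m}" "A $$ (i, j)"] A_max[of j] by simp

lemma A_cover: "j < n \<Longrightarrow> \<exists>i<m. A $$ (i, j) = 1"
proof -
  assume j: "j < n"
  have "Max ((\<lambda>i. A $$ (i, j)) ` {..<m}) \<in> (\<lambda>i. A $$ (i, j)) ` {..<m}"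
    using m_pos by (intro Max_in) auto
  then show ?thesis using A_max[OF j] by auto
qed

lemma mult_mat_vec_index: "x \<in> carrier_vec n \<Longrightarrow> i < m \<Longrightarrow> (A *\<^sub>v x) $ i = (\<Sum>j<n. A $$ (i, j) * x $ j)"
  by (simp add: scalar_prod_def lessThan_atLeast0)

lemma f_r_eq: 
  assumes "x \<in> carrier_vec n"
  shows "f_r A \<epsilon> x = objective (($) x)"
proof -
  have "(A *\<^sub>v map_vec exp x) $ i = load (($) x) i" if "i < m" for i
    using assms that by (subst mult_mat_vec_index) (auto simp: load_def)
  moreover have "ones_vec n \<bullet> x = (\<Sum>j<n. x $ j)"
    using assms by (simp add: scalar_prod_def ones_vec_def lessThan_atLeast0)
  moreover have "\<beta> / (1 + \<beta>) * S = S / q" for S by (simp add: q_def)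
  ultimately show ?thesis
    by (simp add: f_r_def objective_def Let_def q_def[symmetric] del: index_mult_mat_vec times_divide_eq_left)
qed

lemma gradient_eq:
  assumes x: "x \<in> carrier_vec n"
  shows "gradient (f_r A \<epsilon>) x = vec n (grad (($) x))"
proof -
  have "deriv (\<lambda>t. f_r A \<epsilon> (x + t \<cdot>\<^sub>v unit_vec n i)) 0 = grad (($) x) i" if i: "i < n" for i
  proof -
    have "f_r A \<epsilon> (x + t \<cdot>\<^sub>v unit_vec n i) = objective (\<lambda>j. x $ j + t * of_bool (j = i))" for t
      using x i by (subst f_r_eq) (auto intro!: objective_cong)
    then show ?thesis using grad_has_derivative[OF i, of "($) x"] by (simp add: DERIV_imp_deriv)
  qed
  then show ?thesis using x by (auto simp: gradient_def)
qed

section \<open>The iterates as sequences of coordinate functions\<close>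

definition x_seq :: "nat \<Rightarrow> nat \<Rightarrow> real" where "x_seq k j = fst (iterates A \<epsilon> k) $ j"
definition y_seq :: "nat \<Rightarrow> nat \<Rightarrow> real" where "y_seq k j = fst (snd (iterates A \<epsilon> k)) $ j"
definition z_seq :: "nat \<Rightarrow> nat \<Rightarrow> real" where "z_seq k j = snd (snd (iterates A \<epsilon> k)) $ j"

lemma mirror_step_trunc_gradient:
  assumes "x \<in> carrier_vec n" "z \<in> carrier_vec n"
  shows "mirror_step m n \<epsilon> \<eta> (trunc_gradient A \<epsilon> x) z =
    vec n (\<lambda>j. clip \<omega> (z $ j - \<omega> * (\<eta> * min 1 (grad (($) x) j))))"
  using assms omega_pos
  by (subst mirror_step_eq) (auto simp: trunc_gradient_def gradient_eq)

lemma iterates_carrier: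
  "fst (iterates A \<epsilon> k) \<in> carrier_vec n"
  "fst (snd (iterates A \<epsilon> k)) \<in> carrier_vec n"
  "snd (snd (iterates A \<epsilon> k)) \<in> carrier_vec n"
proof (induction k)
  case (Suc k)
  {
    case 1
    show ?case using Suc by (simp add: split_beta Let_def)
    case 2
    show ?case using Suc by (simp add: split_beta Let_def mirror_step_trunc_gradient)
    case 3
    show ?case using Suc by (simp add: split_beta Let_def mirror_step_trunc_gradient)
  }
qed (simp_all add: Let_def ones_vec_def)

lemma seq_0: "j < n \<Longrightarrow> y_seq 0 j = - \<omega>" "j < n \<Longrightarrow> z_seq 0 j = - \<omega>"
  by (simp_all add: y_seq_def z_seq_def Let_def ones_vec_def)

lemma x_seq_Suc: "j < n \<Longrightarrow> x_seq (Suc k) j = \<tau> * z_seq k j + (1 - \<tau>) * y_seq k j"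
  using iterates_carrier[of k] by (simp add: x_seq_def y_seq_def z_seq_def split_beta Let_def)

lemma z_seq_Suc:
  assumes "j < n"
  shows "z_seq (Suc k) j =
    clip \<omega> (z_seq k j - \<omega> * (eta_par m n \<epsilon> (Suc k) * min 1 (grad (x_seq (Suc k)) j)))"
  using iterates_carrier[of k] assms
  by (simp add: x_seq_def[abs_def] y_seq_def z_seq_def split_beta Let_def mirror_step_trunc_gradient del: eta_par.simps)

lemma y_seq_Suc:
  assumes "j < n"
  shows "y_seq (Suc k) j =
    x_seq (Suc k) j + (z_seq (Suc k) j - z_seq k j) / (eta_par m n \<epsilon> (Suc k) * L)"
  using iterates_carrier[of k] assms
  by (simp add: x_seq_def y_seq_def z_seq_def split_beta Let_def mirror_step_trunc_gradient del: eta_par.simps)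

abbreviation "T \<equiv> num_iters m n \<epsilon>"

lemma y_final_in_box: "j < n \<Longrightarrow> y_seq T j \<in> {- \<omega>..0}"
  by (rule accelerated_in_box[where x = x_seq and y = y_seq and z = z_seq, OF omega_pos L_bounds(1) L_gt tau_par_def
      eta_par.simps eta_final_le A_cover seq_0 x_seq_Suc z_seq_Suc y_seq_Suc])

lemma y_final_potential:
  assumes "\<And>j. j < n \<Longrightarrow> u j \<in> {- \<omega>..0}"
  shows "3 * L * eta_par m n \<epsilon> T * (objective (y_seq T) - objective u)
    \<le> objective (\<lambda>_. - \<omega>) - objective u + (\<Sum>j<n. (u j + \<omega>)\<^sup>2 / (2 * \<omega>))"
  by (rule accelerated_potential[where x = x_seq and y = y_seq and z = z_seq, OF omega_pos L_bounds(1) L_gt tau_par_def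
      eta_par.simps eta_final_le A_cover seq_0 x_seq_Suc z_seq_Suc y_seq_Suc assms])

section \<open>Gap and constraint violation of the final point\<close>

lemma load_powr_le_objective:
  assumes "\<And>j. j < n \<Longrightarrow> u j \<le> 0" "i < m"
  shows "load u i powr q / q \<le> objective u"
proof -
  have "(\<Sum>j<n. u j) \<le> 0" using assms by (intro sum_nonpos) auto
  moreover have "load u i powr q / q \<le> (\<Sum>i<m. load u i powr q) / q"
    using assms q_bounds by (intro divide_right_mono member_le_sum) auto
  ultimately show ?thesis by (simp add: objective_def)
qed

lemma regularizer_nonneg: "0 \<le> (\<Sum>i<m. load u i powr q) / q"
  using q_bounds by (intro divide_nonneg_nonneg sum_nonneg) auto

lemma objective_ge: "- (\<Sum>j<n. u j) \<le> objective u"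
  using regularizer_nonneg[of u] by (simp add: objective_def)

lemma objective_nonneg:
  assumes "\<And>j. j < n \<Longrightarrow> u j \<le> 0"
  shows "0 \<le> objective u"
  using objective_ge[of u] sum_nonpos[of "{..<n}" u] assms by fastforce

text \<open>Each load at the lower corner is at most \<open>1 / m\<close>, hence so is its power,
  and the \<open>m\<close> rows together contribute at most
  \<open>1 / q \<le> \<beta> \<le> 1 / 12\<close>.\<close>

lemma objective_start: "objective (\<lambda>_. - \<omega>) \<le> real n * \<omega> + 1 / 12"
proof -
  have "load (\<lambda>_. - \<omega>) i powr q \<le> 1 / real m" if i: "i < m" for i
  proof -
    have "load (\<lambda>_. - \<omega>) i \<le> (\<Sum>j<n. 1 * exp (- \<omega>))"
      unfolding load_def using A_le_1[OF i] by (intro sum_mono mult_right_mono) auto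
    also have "\<dots> = (1 - \<delta>) / real m"
      using n_pos by (simp add: exp_omega M_def)
    also have "\<dots> \<le> 1 / real m" using delta_bounds by (intro divide_right_mono) auto
    finally have le: "load (\<lambda>_. - \<omega>) i \<le> 1 / real m" .
    have "load (\<lambda>_. - \<omega>) i powr q \<le> (1 / real m) powr q"
      using le load_nonneg[OF i] q_bounds by (intro powr_mono2) auto
    also have "\<dots> \<le> (1 / real m) powr 1"
      using q_bounds m_pos by (intro powr_mono') auto
    finally show ?thesis using m_pos by simp
  qed
  then have "(\<Sum>i<m. load (\<lambda>_. - \<omega>) i powr q) \<le> (\<Sum>i<m. 1 / real m)"
    by (intro sum_mono) auto
  then have "(\<Sum>i<m. load (\<lambda>_. - \<omega>) i powr q) / q \<le> 1 / q"
    using m_pos q_bounds by (intro divide_right_mono) auto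
  also have "\<dots> \<le> 1 / 12" using q_bounds beta_bounds by linarith
  finally show ?thesis by (simp add: objective_def)
qed

text \<open>The initial potential is at most \<open>3 / 2 * (n * \<omega>) + 1 / 12\<close>, which
  is at most \<open>R * \<epsilon>\<close>, while the gap carries a factor of at least
  \<open>R\<close>. The split on its sign allows multiplying
  \<open>R \<le> (1 / (1 - \<tau>)) ^ T\<close> by the gap.\<close>

lemma convergence_gap:
  assumes u: "\<And>j. j < n \<Longrightarrow> u j \<in> {- \<omega>..0}"
  shows "objective (y_seq T) - objective u \<le> \<epsilon>"
proof (cases "objective (y_seq T) \<le> objective u")
  case True
  then show ?thesis using eps_pos by linarith
next
  case False
  have "(u j + \<omega>)\<^sup>2 / (2 * \<omega>) \<le> \<omega> / 2" if "j < n" for j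
  proof -
    have "(u j + \<omega>)\<^sup>2 \<le> \<omega>\<^sup>2" using u[OF that] omega_pos by (intro power_mono) auto
    then show ?thesis using omega_pos by (simp add: field_simps power2_eq_square)
  qed
  then have "(\<Sum>j<n. (u j + \<omega>)\<^sup>2 / (2 * \<omega>)) \<le> (\<Sum>j<n. \<omega> / 2)" by (intro sum_mono) auto
  moreover have "0 \<le> objective u" using u by (intro objective_nonneg) auto
  moreover have "(\<Sum>j<n. \<omega> / 2) = real n * \<omega> / 2" by simp
  ultimately have "3 * L * eta_par m n \<epsilon> T * (objective (y_seq T) - objective u)
      \<le> 3 / 2 * (real n * \<omega>) + 1 / 12"
    using y_final_potential[of u, OF u] objective_start by linarith
  moreover have "3 * L * eta_par m n \<epsilon> T = (1 / (1 - \<tau>)) ^ T"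
    using L_gt unfolding eta_eq by simp
  moreover have "R * (objective (y_seq T) - objective u) \<le> (1 / (1 - \<tau>)) ^ T * (objective (y_seq T) - objective u)"
    using rate_power_bounds(1) False by (intro mult_right_mono) auto
  ultimately have "R * (objective (y_seq T) - objective u) \<le> 3 / 2 * (real n * \<omega>) + 1 / 12"
    by simp
  also have "\<dots> \<le> 4 * real n * ln (2 * M)"
  proof -
    have "real n * \<omega> \<le> real n * ln (2 * M)" using omega_le by (intro mult_left_mono) auto
    moreover have "1 * (1 / 2) \<le> real n * ln (2 * M)"
      using ln_2M_bounds n_pos by (intro mult_mono) auto
    ultimately show ?thesis by linarith
  qed
  also have "\<dots> = R * \<epsilon>" using eps_pos by (simp add: R_def)
  finally show ?thesis using R_ge_4 by simp
qed

text \<open>A load above \<open>1 + \<delta>\<close> has a power of at least \<open>K ^ 3\<close>,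
  so its row alone forces the objective up to \<open>4 * (M * M) / 3\<close>. The convergence
  guarantee leaves less than that.\<close>

lemma load_final_le:
  assumes i: "i < m"
  shows "load (y_seq T) i \<le> 1 + \<delta>"
proof (rule ccontr)
  assume "\<not> load (y_seq T) i \<le> 1 + \<delta>"
  then have less: "1 + \<delta> \<le> load (y_seq T) i" by simp
  have "\<delta>\<^sup>2 \<le> \<delta> * (1 / 2)"
    using delta_bounds unfolding power2_eq_square by (intro mult_left_mono) auto
  then have "\<delta> / 2 \<le> ln (1 + \<delta>)"
    using ln_one_plus_pos_lower_bound[of \<delta>] delta_bounds by linarith
  then have "1 / \<beta> * (\<delta> / 2) \<le> q * ln (1 + \<delta>)"
    using q_bounds beta_bounds delta_bounds by (intro mult_mono) auto
  moreover have "1 / \<beta> * (\<delta> / 2) = 3 * ln K"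
    using delta_bounds by (simp add: inverse_beta)
  ultimately have "exp (3 * ln K) \<le> (1 + \<delta>) powr q"
    using delta_bounds by (simp add: powr_def)
  moreover have "exp (3 * ln K) = K ^ 3"
    using K_ge_4 exp_of_nat_mult[of 3 "ln K"] by simp
  ultimately have "K ^ 3 \<le> (1 + \<delta>) powr q" by simp
  also have "\<dots> \<le> load (y_seq T) i powr q"
    using less delta_bounds q_bounds by (intro powr_mono2) auto
  finally have K3: "K ^ 3 \<le> load (y_seq T) i powr q" .
  \<comment> \<open>\<open>ln K \<le> K / 2\<close> bounds \<open>\<beta>\<close> from below, so
    that one of the three factors \<open>K\<close> pays for \<open>1 / q\<close>.\<close>
  have "\<delta> / (6 * (K / 2)) / 2 \<le> \<beta> / 2"
    unfolding beta_eq using ln_K_le ln_K_ge delta_bounds K_ge_4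
    by (intro divide_right_mono divide_left_mono mult_pos_pos) auto
  then have inv_q: "\<delta> / (6 * K) \<le> 1 / q" using q_bounds by simp
  have "4 * (M * M) / 3 \<le> K * M / 3"
    using K_ge M_ge_1 by (simp add: mult_right_mono mult.assoc[symmetric] del: mult_le_cancel_right)
  also have "\<dots> = K * (K * \<delta>) / 6" by (simp add: K_delta)
  also have "\<dots> = K ^ 3 * (\<delta> / (6 * K))"
    using K_ge_4 by (simp add: power3_eq_cube)
  also have "\<dots> \<le> load (y_seq T) i powr q * (1 / q)"
    using K3 inv_q K_ge_4 delta_bounds by (intro mult_mono) auto
  also have "\<dots> \<le> objective (y_seq T)"
    using load_powr_le_objective[of "y_seq T" i] y_final_in_box i by auto
  \<comment> \<open>The lower corner is a comparison point whose objective value has an explicit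
    bound.\<close>
  also have "\<dots> \<le> objective (\<lambda>_. - \<omega>) + \<epsilon>"
    using convergence_gap[of "\<lambda>_. - \<omega>"] omega_pos by simp
  also have "\<dots> \<le> real n * \<omega> + 1 / 12 + real n / 2"
    using objective_start eps_le by linarith
  also have "\<dots> \<le> real n * (M - 11 / 36) + 1 / 12 * real n + real n / 2"
  proof -
    have "real n * \<omega> \<le> real n * (M - 11 / 36)"
      using omega_le ln_2M_bounds by (intro mult_left_mono) auto
    moreover have "1 \<le> real n" using n_pos by simp
    ultimately show ?thesis by linarith
  qed
  also have "\<dots> < real n * M + real n / 3"
    using n_pos by (simp add: algebra_simps)
  also have "\<dots> \<le> 4 * (real n * M) / 3"
    using M_ge_1 mult_left_mono[of 1 M "real n"] by simp
  also have "\<dots> \<le> 4 * (M * M) / 3"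
    using n_le_M M_ge_1 by (intro divide_right_mono mult_left_mono mult_right_mono) auto
  finally show False by simp
qed

section \<open>The proportionally fair allocation\<close>

lemma feasible_iff:
  "x \<in> feasible_set A \<longleftrightarrow> x \<in> carrier_vec n \<and> (\<forall>j<n. 0 \<le> x $ j) \<and> (\<forall>i<m. (\<Sum>j<n. A $$ (i, j) * x $ j) \<le> 1)"
  by (auto simp: feasible_set_def less_eq_vec_def ones_vec_def mult_mat_vec_index simp del: index_mult_mat_vec)

lemma feasible_convex:
  assumes "x \<in> feasible_set A" "y \<in> feasible_set A" "0 \<le> t" "t \<le> 1"
  shows "vec n (\<lambda>j. (1 - t) * x $ j + t * y $ j) \<in> feasible_set A"
proof -
  have "(\<Sum>j<n. A $$ (i, j) * ((1 - t) * x $ j + t * y $ j)) \<le> 1" if i: "i < m" for i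
  proof -
    have "(\<Sum>j<n. A $$ (i, j) * ((1 - t) * x $ j + t * y $ j))
        = (1 - t) * (\<Sum>j<n. A $$ (i, j) * x $ j) + t * (\<Sum>j<n. A $$ (i, j) * y $ j)"
      by (simp add: distrib_left sum.distrib sum_distrib_left mult.left_commute)
    also have "\<dots> \<le> (1 - t) * 1 + t * 1"
      using assms i by (intro add_mono mult_left_mono) (auto simp: feasible_iff)
    finally show ?thesis by simp
  qed
  then show ?thesis using assms by (auto simp: feasible_iff)
qed

lemma unit_vec_feasible: "j < n \<Longrightarrow> unit_vec n j \<in> feasible_set A"
  using A_le_1 by (auto simp: feasible_iff unit_vec_def if_distrib cong: if_cong)

lemma uniform_feasible: "vec n (\<lambda>_. 1 / real n) \<in> feasible_set A"
proof -
  have "(\<Sum>j<n. A $$ (i, j) * (1 / real n)) \<le> 1" if "i < m" for i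
  proof -
    have "(\<Sum>j<n. A $$ (i, j) * (1 / real n)) \<le> (\<Sum>j<n. 1 * (1 / real n))"
      using A_le_1[OF that] by (intro sum_mono mult_right_mono) auto
    then show ?thesis using n_pos by simp
  qed
  then show ?thesis by (simp add: feasible_iff)
qed

lemma feasible_le_1:
  assumes "x \<in> feasible_set A" "j < n"
  shows "x $ j \<le> 1"
proof -
  obtain i where i: "i < m" "A $$ (i, j) = 1" using A_cover[OF assms(2)] by blast
  have "A $$ (i, j) * x $ j \<le> (\<Sum>j<n. A $$ (i, j) * x $ j)"
    using assms i a_nonneg by (intro member_le_sum) (auto simp: feasible_iff)
  then show ?thesis using i assms by (fastforce simp: feasible_iff)
qed

lemma fair_obj_pos:
  assumes "x \<in> carrier_vec n" "\<And>j. j < n \<Longrightarrow> 0 < x $ j"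
  shows "fair_obj x = ereal (\<Sum>j<n. ln (x $ j))"
  using assms by (simp add: fair_obj_def ext_log_def)

lemma fair_obj_MInfty:
  assumes "x \<in> carrier_vec n" "j < n" "x $ j \<le> 0"
  shows "fair_obj x = - \<infinity>"
proof -
  \<comment> \<open>In \<open>ereal\<close>, \<open>- \<infinity> + \<infinity>\<close> is
    \<open>\<infinity>\<close>, so the other terms must be shown not to reach
    \<open>\<infinity>\<close>.\<close>
  have "(\<Sum>k\<in>{..<n} - {j}. ext_log (x $ k)) \<noteq> \<infinity>"
    by (subst sum_Pinfty) (auto simp: ext_log_def)
  moreover have "fair_obj x = ext_log (x $ j) + (\<Sum>k\<in>{..<n} - {j}. ext_log (x $ k))"
    using assms by (simp add: fair_obj_def sum.remove[of "{..<n}" j])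
  ultimately show ?thesis using assms by (simp add: ext_log_def)
qed

text \<open>The uniform point is feasible and has a finite value, which rules out
  \<open>- \<infinity>\<close> at a maximizer.\<close>

lemma fair_opt_pos:
  assumes opt: "is_arg_max fair_obj (\<lambda>x. x \<in> feasible_set A) x" and j: "j < n"
  shows "0 < x $ j"
proof (rule ccontr)
  assume "\<not> 0 < x $ j"
  then have "fair_obj x = - \<infinity>"
    using opt j by (intro fair_obj_MInfty) (auto simp: is_arg_max_def feasible_iff)
  moreover have "fair_obj (vec n (\<lambda>_. 1 / real n)) = ereal (\<Sum>j<n. ln (vec n (\<lambda>_. 1 / real n) $ j))"
    using n_pos by (intro fair_obj_pos) auto
  ultimately have "fair_obj x < fair_obj (vec n (\<lambda>_. 1 / real n))" by simp
  then show False using opt uniform_feasible by (auto simp: is_arg_max_def)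
qed

text \<open>First-order optimality in the direction of the feasible point \<open>e\<^sub>j\<close>.\<close>

lemma fair_opt_ge:
  assumes opt: "is_arg_max fair_obj (\<lambda>x. x \<in> feasible_set A) x" and j: "j < n"
  shows "1 / real n \<le> x $ j"
proof (rule ccontr)
  assume small: "\<not> 1 / real n \<le> x $ j"
  have x: "x \<in> feasible_set A" "x \<in> carrier_vec n" using opt by (auto simp: is_arg_max_def feasible_iff)
  note pos = fair_opt_pos[OF opt]
  define s where "s = 1 / x $ j"
  have s: "real n < s" "0 < s" using small pos[OF j] n_pos by (auto simp: s_def field_simps)
  \<comment> \<open>\<open>s - n\<close> is the first-order gain towards
    \<open>unit_vec n j\<close>. This \<open>t\<close> makes \<open>n * s * t\<close> equal to it,
    so that the second-order loss stays below the gain.\<close>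
  define t where "t = (s - n) / (n * s)"
  have "s - n < n * s"
    using s n_pos mult_right_mono[of 1 "real n" s] by linarith
  then have t: "0 < t" "t < 1" using s n_pos by (auto simp: t_def)
  define x' where "x' = vec n (\<lambda>k. (1 - t) * x $ k + t * unit_vec n j $ k)"
  have x'_feasible: "x' \<in> feasible_set A"
    unfolding x'_def using t x unit_vec_feasible[OF j] by (intro feasible_convex) auto
  have x'_pos: "0 < x' $ k" if "k < n" for k
    using t pos[OF that] that j by (auto simp: x'_def add_pos_nonneg)
  have x'_j: "x' $ j = x $ j * (1 - t + t * s)"
    using j pos[OF j] by (simp add: x'_def s_def field_simps)
  have "0 < 1 - t + t * s" using t s by (intro add_pos_pos) auto
  then have ln_j: "ln (x' $ j) = ln (x $ j) + ln (1 - t + t * s)"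
    unfolding x'_j using pos[OF j] by (intro ln_mult_pos) auto
  have ln_k: "ln (x' $ k) = ln (x $ k) + ln (1 - t)" if "k < n" "k \<noteq> j" for k
  proof -
    have "x' $ k = x $ k * (1 - t)" using that j by (simp add: x'_def)
    then show ?thesis using pos[OF that(1)] t by (simp add: ln_mult_pos)
  qed
  have "(\<Sum>k<n. ln (x' $ k)) = ln (x' $ j) + (\<Sum>k\<in>{..<n} - {j}. ln (x' $ k))"
    using j by (simp add: sum.remove)
  also have "(\<Sum>k\<in>{..<n} - {j}. ln (x' $ k)) = (\<Sum>k\<in>{..<n} - {j}. ln (x $ k) + ln (1 - t))"
    by (intro sum.cong) (auto simp: ln_k)
  also have "\<dots> = (\<Sum>k\<in>{..<n} - {j}. ln (x $ k)) + (n - 1) * ln (1 - t)"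
    using j by (simp add: sum.distrib)
  finally have "(\<Sum>k<n. ln (x' $ k)) = (\<Sum>k<n. ln (x $ k)) + ((n - 1) * ln (1 - t) + ln (1 - t + t * s))"
    using j by (simp add: ln_j sum.remove[of "{..<n}" j "\<lambda>k. ln (x $ k)"])
  moreover have "(\<Sum>k<n. ln (x' $ k)) \<le> (\<Sum>k<n. ln (x $ k))"
  proof -
    have "\<not> fair_obj x < fair_obj x'" using opt x'_feasible by (auto simp: is_arg_max_def)
    then show ?thesis
      using x pos x'_pos by (simp add: fair_obj_pos x'_def)
  qed
  ultimately have "(n - 1) * ln (1 - t) + ln (1 - t + t * s) \<le> 0" by simp
  then have "exp ((n - 1) * ln (1 - t) + ln (1 - t + t * s)) \<le> 1" by simp
  then have le_1: "(1 - t) ^ (n - 1) * (1 - t + t * s) \<le> 1"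
    using t \<open>0 < 1 - t + t * s\<close> by (simp only: exp_add exp_of_nat_mult exp_ln)
  \<comment> \<open>Bernoulli's inequality turns the product into a quadratic polynomial in
    \<open>t\<close>.\<close>
  have "1 + real (n - 1) * (- t) \<le> (1 + (- t)) ^ (n - 1)"
    using t by (intro Bernoulli_inequality) auto
  then have "(1 - (real n - 1) * t) * (1 - t + t * s) \<le> (1 - t) ^ (n - 1) * (1 - t + t * s)"
    using \<open>0 < 1 - t + t * s\<close> n_pos by (intro mult_right_mono) (auto simp: of_nat_diff)
  then have "(1 - (real n - 1) * t) * (1 - t + t * s) \<le> 1" using le_1 by linarith
  then have "t * (s - n) \<le> t * ((real n - 1) * (s - 1) * t)"
    by (simp add: algebra_simps)
  then have "s - n \<le> (real n - 1) * (s - 1) * t" using t by simp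
  also have "\<dots> < n * s * t"
  proof -
    have "(real n - 1) * (s - 1) = n * s - n - (s - 1)" by (simp add: algebra_simps)
    also have "\<dots> < n * s" using s n_pos by simp
    finally show ?thesis using t by (intro mult_strict_right_mono) auto
  qed
  also have "\<dots> = s - n" using s n_pos by (simp add: t_def)
  finally show False by simp
qed

text \<open>The shift scales \<open>x\<close> by \<open>1 - \<delta>\<close>, which brings every
  load power down to \<open>1 / K\<close>, so the regularizer is at most \<open>\<epsilon>\<close>.
  The linear term pays \<open>- (n * ln (1 - \<delta>)) \<le> 2 * \<epsilon>\<close>.\<close>

lemma objective_fair_opt_le:
  assumes x: "x \<in> feasible_set A" and pos: "\<And>j. j < n \<Longrightarrow> 0 < x $ j"
  shows "objective (\<lambda>j. ln (x $ j) + ln (1 - \<delta>)) \<le> - (\<Sum>j<n. ln (x $ j)) + 3 * \<epsilon>"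
proof -
  define u where "u = (\<lambda>j. ln (x $ j) + ln (1 - \<delta>))"
  have "load u i powr q \<le> 1 / K" if i: "i < m" for i
  proof -
    have "load u i = (1 - \<delta>) * (\<Sum>j<n. A $$ (i, j) * x $ j)"
      using pos delta_bounds by (simp add: load_def u_def exp_add sum_distrib_left mult_ac)
    also have "\<dots> \<le> (1 - \<delta>) * 1"
      using x i delta_bounds by (intro mult_left_mono) (auto simp: feasible_iff)
    finally have "load u i powr q \<le> (1 - \<delta>) powr q"
      using load_nonneg[OF i, of u] q_bounds by (intro powr_mono2) auto
    also have "\<dots> = exp (q * ln (1 - \<delta>))" using delta_bounds by (simp add: powr_def)
    also have "\<dots> \<le> exp (- ln K)"
    proof -
      have "ln K \<le> 1 / \<beta> * \<delta>" using delta_bounds ln_K_ge by (simp add: inverse_beta)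
      also have "\<dots> \<le> q * (- ln (1 - \<delta>))"
        using q_bounds delta_bounds beta_bounds ln_le_minus_one[of "1 - \<delta>"] by (intro mult_mono) auto
      finally show ?thesis by simp
    qed
    also have "\<dots> = 1 / K" using K_ge_4 by (simp add: exp_minus inverse_eq_divide)
    finally show ?thesis .
  qed
  then have "(\<Sum>i<m. load u i powr q) \<le> (\<Sum>i<m. 1 / K)" by (intro sum_mono) auto
  also have "\<dots> = \<epsilon> / (2 * (real n)\<^sup>2)" using m_pos by (simp add: K_def)
  also have "\<dots> \<le> \<epsilon> / 1"
  proof -
    have "1 \<le> (real n)\<^sup>2" using n_pos by (intro one_le_power) simp
    then have "1 \<le> 2 * (real n)\<^sup>2" by simp
    then show ?thesis using eps_pos n_pos by (intro divide_left_mono) auto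
  qed
  finally have "(\<Sum>i<m. load u i powr q) / q \<le> \<epsilon> / 1"
    using q_bounds eps_pos by (intro frac_le) auto
  moreover have "- (real n * ln (1 - \<delta>)) \<le> 2 * \<epsilon>"
  proof -
    have "2 * \<delta>\<^sup>2 \<le> 2 * (\<delta> * (1 / 2))"
      using delta_bounds unfolding power2_eq_square by (intro mult_left_mono) auto
    then have "- ln (1 - \<delta>) \<le> 2 * \<delta>"
      using ln_one_minus_pos_lower_bound[of \<delta>] delta_bounds by linarith
    then have "real n * - ln (1 - \<delta>) \<le> real n * (2 * \<delta>)" by (intro mult_left_mono) auto
    then show ?thesis using n_pos by (simp add: \<delta>_def)
  qed
  ultimately show ?thesis
    by (simp add: objective_def u_def[symmetric]) (simp add: u_def sum.distrib)
qed

text \<open>The convergence gap contributes \<open>\<epsilon>\<close> and the comparison point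
  \<open>3 * \<epsilon>\<close>. That point stays above the lower corner because its shift matches
  \<open>exp (- \<omega>) = (1 - \<delta>) / M\<close>.\<close>

lemma fair_opt_gap:
  assumes opt: "is_arg_max fair_obj (\<lambda>x. x \<in> feasible_set A) x"
  shows "(\<Sum>j<n. ln (x $ j)) - (\<Sum>j<n. y_seq T j) \<le> 4 * \<epsilon>"
proof -
  have x: "x \<in> feasible_set A" using opt by (auto simp: is_arg_max_def)
  note pos = fair_opt_pos[OF opt]
  have box: "ln (x $ j) + ln (1 - \<delta>) \<in> {- \<omega>..0}" if j: "j < n" for j
  proof -
    have "1 / M \<le> 1 / real n" using n_pos n_le_M M_ge_1 by (intro divide_left_mono) auto
    then have "1 / M \<le> x $ j" using fair_opt_ge[OF opt j] by linarith
    then have "(1 - \<delta>) * (1 / M) \<le> (1 - \<delta>) * x $ j"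
      using delta_bounds by (intro mult_left_mono) auto
    then have "exp (- \<omega>) \<le> exp (ln (x $ j) + ln (1 - \<delta>))"
      using pos[OF j] delta_bounds by (simp add: exp_omega exp_add mult.commute)
    moreover have "ln (x $ j) \<le> 0" "ln (1 - \<delta>) \<le> 0"
      using feasible_le_1[OF x j] pos[OF j] delta_bounds by auto
    ultimately show ?thesis by simp
  qed
  have "objective (y_seq T) - objective (\<lambda>j. ln (x $ j) + ln (1 - \<delta>)) \<le> \<epsilon>"
    using box by (rule convergence_gap)
  moreover have "objective (\<lambda>j. ln (x $ j) + ln (1 - \<delta>)) \<le> - (\<Sum>j<n. ln (x $ j)) + 3 * \<epsilon>"
    using x pos by (rule objective_fair_opt_le)
  ultimately show ?thesis
    using objective_ge[of "y_seq T"] by linarith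
qed

text \<open>The sign suffices: a nonnegative ratio can only enlarge \<open>log_factor\<close>.
  Normalization supplies an entry 1, so the set under \<open>Min\<close> is nonempty.\<close>

lemma entry_ratio_nonneg: "0 \<le> entry_ratio A"
proof -
  have fin: "finite (elements_mat A)" by (simp add: elements_mat_def)
  have nonneg: "0 \<le> a" if "a \<in> elements_mat A" for a
    using elements_matD[OF that] a_nonneg by auto
  obtain i where "i < m" "A $$ (i, 0) = 1" using A_cover[OF n_pos] by blast
  then have one: "1 \<in> elements_mat A" using A_carrier n_pos by (intro elements_matI) auto
  have "1 \<le> Max (elements_mat A)" using fin one by (intro Max_ge) auto
  moreover have "Min (elements_mat A - {0}) \<in> elements_mat A - {0}"
    using fin one by (intro Min_in) auto
  ultimately show ?thesis
    using nonneg by (auto simp: entry_ratio_def intro!: divide_nonneg_nonneg)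
qed

section \<open>Transfer to vectors and the scaled output\<close>

lemma y_iter_carrier: "y_iter A \<epsilon> k \<in> carrier_vec n"
  by (simp add: y_iter_def iterates_carrier)

lemma y_seq_eq: "y_seq k = ($) (y_iter A \<epsilon> k)"
  by (simp add: y_seq_def[abs_def] y_iter_def)

lemma y_final_in_dom_box: "y_iter A \<epsilon> T \<in> dom_box m n \<epsilon>"
  using y_final_in_box y_iter_carrier by (auto simp: dom_box_def y_seq_eq)

lemma f_r_gap:
  assumes "u \<in> dom_box m n \<epsilon>"
  shows "f_r A \<epsilon> (y_iter A \<epsilon> T) - f_r A \<epsilon> u \<le> \<epsilon>"
  using assms convergence_gap[of "($) u"] y_iter_carrier
  by (auto simp: dom_box_def f_r_eq y_seq_eq)

definition x_bar :: "real vec" where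
  "x_bar = (1 / (1 + \<epsilon> / real n)) \<cdot>\<^sub>v map_vec exp (y_iter A \<epsilon> T)"

lemma x_bar_carrier: "x_bar \<in> carrier_vec n"
  using y_iter_carrier by (simp add: x_bar_def)

lemma x_bar_index: "j < n \<Longrightarrow> x_bar $ j = exp (y_seq T j) / (1 + \<delta>)"
  using y_iter_carrier[of T] by (simp add: x_bar_def y_seq_eq \<delta>_def)

lemma x_bar_feasible: "x_bar \<in> feasible_set A"
proof -
  have "(\<Sum>j<n. A $$ (i, j) * x_bar $ j) = load (y_seq T) i / (1 + \<delta>)" for i
    by (simp add: x_bar_index load_def sum_divide_distrib)
  then show ?thesis
    using load_final_le delta_bounds by (auto simp: feasible_iff x_bar_carrier x_bar_index)
qed

text \<open>Scaling down by \<open>1 + \<delta>\<close> costs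
  \<open>n * ln (1 + \<delta>) \<le> n * \<delta> = \<epsilon>\<close>, the fifth
  \<open>\<epsilon>\<close> of the final gap.\<close>

lemma fair_obj_x_bar: "- \<epsilon> \<le> (\<Sum>j<n. ln (x_bar $ j)) - (\<Sum>j<n. y_seq T j)"
  "fair_obj x_bar = ereal (\<Sum>j<n. ln (x_bar $ j))"
proof -
  have "real n * ln (1 + \<delta>) \<le> real n * \<delta>"
    using delta_bounds ln_add_one_self_le_self[of \<delta>] by (intro mult_left_mono) auto
  also have "\<dots> = \<epsilon>" using n_pos by (simp add: \<delta>_def)
  finally show "- \<epsilon> \<le> (\<Sum>j<n. ln (x_bar $ j)) - (\<Sum>j<n. y_seq T j)"
    using delta_bounds by (simp add: x_bar_index ln_div sum_subtractf)
  show "fair_obj x_bar = ereal (\<Sum>j<n. ln (x_bar $ j))"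
    using delta_bounds by (intro fair_obj_pos x_bar_carrier) (simp add: x_bar_index)
qed

lemma fair_obj_gap:
  assumes opt: "is_arg_max fair_obj (\<lambda>x. x \<in> feasible_set A) x"
  shows "fair_obj x - fair_obj x_bar \<le> ereal (5 * \<epsilon>)"
proof -
  have "fair_obj x = ereal (\<Sum>j<n. ln (x $ j))"
    using opt fair_opt_pos[OF opt] by (intro fair_obj_pos) (auto simp: is_arg_max_def feasible_iff)
  then show ?thesis
    using fair_opt_gap[OF opt] fair_obj_x_bar by simp
qed

end

theorem theorem6:
  shows "\<exists>(C::real) (p::nat). \<forall>(m::nat) (n::nat) (A::real mat) (\<epsilon>::real).
    normalized_matrix m n A \<longrightarrow> 0 < \<epsilon> \<longrightarrow> \<epsilon> \<le> real n / 2 \<longrightarrow>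
    (let T = num_iters m n \<epsilon>;
         y = y_iter A \<epsilon> T;
         x_bar = (1 / (1 + \<epsilon> / real n)) \<cdot>\<^sub>v map_vec exp y
     in y \<in> dom_box m n \<epsilon>
      \<and> (\<forall>x_r. is_arg_min (f_r A \<epsilon>) (\<lambda>x. x \<in> dom_box m n \<epsilon>) x_r \<longrightarrow>
            f_r A \<epsilon> y - f_r A \<epsilon> x_r \<le> \<epsilon>)
      \<and> real T \<le> C * (real n / \<epsilon>) * log_factor m n \<epsilon> (entry_ratio A) ^ p
      \<and> x_bar \<in> feasible_set A
      \<and> (\<forall>x_opt. is_arg_max fair_obj (\<lambda>x. x \<in> feasible_set A) x_opt \<longrightarrow>
            fair_obj x_opt - fair_obj x_bar \<le> ereal (5 * \<epsilon>)))"
proof (rule exI[of _ 13000], rule exI[of _ 3], intro allI impI)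
  \<comment> \<open>The constant and the exponent come from \<open>num_iters_bound\<close> and are
    fixed before the instance. \<open>f_r_gap\<close> holds for every point of the box, hence for a
    minimizer.\<close>
  fix m n A and \<epsilon> :: real
  assume "normalized_matrix m n A" "0 < \<epsilon>" "\<epsilon> \<le> real n / 2"
  then interpret packing_instance m n \<epsilon> A
    by unfold_locales (auto simp: normalized_matrix_def)
  show "let T = num_iters m n \<epsilon>;
         y = y_iter A \<epsilon> T;
         x_bar = (1 / (1 + \<epsilon> / real n)) \<cdot>\<^sub>v map_vec exp y
     in y \<in> dom_box m n \<epsilon>
      \<and> (\<forall>x_r. is_arg_min (f_r A \<epsilon>) (\<lambda>x. x \<in> dom_box m n \<epsilon>) x_r \<longrightarrow>
            f_r A \<epsilon> y - f_r A \<epsilon> x_r \<le> \<epsilon>)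
      \<and> real T \<le> 13000 * (real n / \<epsilon>) * log_factor m n \<epsilon> (entry_ratio A) ^ 3
      \<and> x_bar \<in> feasible_set A
      \<and> (\<forall>x_opt. is_arg_max fair_obj (\<lambda>x. x \<in> feasible_set A) x_opt \<longrightarrow>
            fair_obj x_opt - fair_obj x_bar \<le> ereal (5 * \<epsilon>))"
    unfolding Let_def x_bar_def[symmetric]
    using y_final_in_dom_box f_r_gap num_iters_bound[OF entry_ratio_nonneg] x_bar_feasible fair_obj_gap
    by (simp add: is_arg_min_def)
qed

end
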